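(* Let $\phi\in\mathcal{S}_d$ be such that $\sup_{\xi\in\mathbb{R}^d}|\hat\phi(\xi)|=1$ and suppose that every point $\xi\in\Omega(\phi)$ is of positive homogeneous type for $\hat\phi$. Let $\xi_1,\xi_2,\dots,\xi_A$ be the distinct points $\xi\in\Omega(\phi)$ for which $\mu_{P_{\xi}}=\mu_\phi$, and set $\alpha_q=\alpha_{\xi_q}$ and $P_q=P_{\xi_q}$ for $q=1,\dots,A$. Then $$\phi^{(n)}(x)=\sum_{q=1}^A e^{-ix\cdot \xi_q}\,\hat\phi(\xi_q)^n\, H^n_{P_q}(x-n\alpha_q)+o(n^{-\mu_\phi})\qquad (n\to\infty)$$ uniformly for $x\in\mathbb{Z}^d$.
   Context: Let $d\ge 1$. For $\phi:\mathbb{Z}^d\to\mathbb{C}$ with $\sum_x|\phi(x)|<\infty$, set $\phi^{(1)}=\phi$ and $\phi^{(n)}=\phi^{(n-1)}*\phi$, where $(\psi*\phi)(x)=\sum_{y\in\mathbb{Z}^d}\psi(x-y)\phi(y)$. $\mathcal{S}_d$ is the set of $\phi:\mathbb{Z}^d\to\mathbb{C}$ such that $\sum_{x}|x^\beta\phi(x)|<\infty$ for all multi-indices $\beta\in\mathbb{N}^d$ (including $\beta=0$). The Fourier transform is $\hat\phi(\xi)=\sum_{x\in\mathbb{Z}^d}\phi(x)e^{ix\cdot\xi}$, $\xi\in\mathbb{R}^d$. Let $\mathbb{T}^d=(-\pi,\pi]^d$. For $E\in M_d(\mathbb{R})$ and $t>0$, $t^E=\exp((\log t)E)$. For a continuous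 $P:\mathbb{R}^d\to\mathbb{C}$, $\mathrm{Exp}(P)$ is the set of $E\in M_d(\mathbb{R})$ with $tP(\xi)=P(t^E\xi)$ for all $t>0$, $\xi\in\mathbb{R}^d$. $P$ is positive homogeneous if $R=\operatorname{Re}P$ is positive definite ($R(\xi)\ge 0$, with $R(\xi)=0$ only when $\xi=0$) and $\mathrm{Exp}(P)$ contains a matrix with real spectrum. For a positive homogeneous polynomial $P$ (complex coefficients, $d$ real variables), $\mu_P:=\operatorname{tr}E$ for any $E\in\mathrm{Exp}(P)$ (this is independent of the choice of $E$), and for $t>0$, $x\in\mathbb{R}^d$, $$H_P^t(x)=\frac{1}{(2\pi)^d}\int_{\mathbb{R}^d}e^{-tP(\xi)}e^{-ix\cdot\xi}\,d\xi .$$ For $\phi\in\mathcal{S}_d$ with $\sup|\hat\phi|=1$, $\Omega(\phi)=\{\xi\in\mathbb{T}^d:|\hat\phi(\xi)|=1\}$. For $\xi_0\in\Omega(\phi)$ put $\Gamma_{\xi_0}(\xi)=\log\big(\hat\phi(\xi+\xi_0)/\hat\phi(\xi_0)\big)$ (principal branch) on a sufficiently small convex open neighborhood $\mathcal{U}$ of $0$. The point $\xi_0$ is of positive homogeneous type for $\hat\phi$ if the Taylor expansion of $\Gamma_{\xi_0}$ about $0$ is of the form $\Gamma_{\xi_0}(\xi)=i\alpha_{\xi_0}\cdot\xi-P_{\xi_0}(\xi)+\Upsilon_{\xi_0}(\xi)$, where $\alpha_{\xi_0}\in\mathbb{R}^d$ (the drift), $P_{\xi_0}$ is a positive homogeneous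 polynomial, and $\Upsilon_{\xi_0}(\xi)=o(\operatorname{Re}P_{\xi_0}(\xi))$ as $\xi\to 0$; then $\alpha_{\xi_0}$ and $P_{\xi_0}$ are unique. If every point of $\Omega(\phi)$ is of positive homogeneous type, then $\Omega(\phi)$ is finite and $\mu_\phi:=\min_{\xi\in\Omega(\phi)}\mu_{P_\xi}$. *)

theory Defs
  imports "HOL-Analysis.Analysis" "HOL-Library.Landau_Symbols"
begin

(* The lattice Z^d is the type int ^ 'd and R^d is real ^ 'd, with d = CARD('d). *)

definition real_vec :: "int ^ 'd \<Rightarrow> real ^ 'd" where
  "real_vec x = (\<chi> i. real_of_int (x $ i))"

definition Schwartz :: "(int ^ 'd \<Rightarrow> complex) set" where
  "Schwartz = {\<phi>. \<forall>\<beta> :: 'd \<Rightarrow> nat.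
     (\<lambda>x. norm ((\<Prod>i\<in>UNIV. of_int (x $ i) ^ \<beta> i) * \<phi> x)) summable_on UNIV}"

definition convolution :: "(int ^ 'd \<Rightarrow> complex) \<Rightarrow> (int ^ 'd \<Rightarrow> complex) \<Rightarrow> int ^ 'd \<Rightarrow> complex" where
  "convolution \<psi> \<phi> x = (\<Sum>\<^sub>\<infinity>y. \<psi> (x - y) * \<phi> y)"

(* The powers of interest start at n = 1; the value at n = 0 is the convolution unit. *)
fun conv_power :: "(int ^ 'd \<Rightarrow> complex) \<Rightarrow> nat \<Rightarrow> int ^ 'd \<Rightarrow> complex" where
  "conv_power \<phi> 0 = (\<lambda>x. if x = 0 then 1 else 0)"
| "conv_power \<phi> (Suc 0) = \<phi>"
| "conv_power \<phi> (Suc (Suc n)) = convolution (conv_power \<phi> (Suc n)) \<phi>"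

definition fourier :: "(int ^ 'd \<Rightarrow> complex) \<Rightarrow> real ^ 'd \<Rightarrow> complex" where
  "fourier \<phi> \<xi> = (\<Sum>\<^sub>\<infinity>x. \<phi> x * exp (\<i> * complex_of_real (real_vec x \<bullet> \<xi>)))"

definition torus :: "(real ^ 'd) set" where
  "torus = {\<xi>. \<forall>i. - pi < \<xi> $ i \<and> \<xi> $ i \<le> pi}"

(* The class multiplication on vec is componentwise, so the library function exp is not the
   matrix exponential. *)
definition mat_exp :: "real ^ 'd ^ 'd \<Rightarrow> real ^ 'd ^ 'd" where
  "mat_exp E = (\<Sum>k. (1 / fact k) *\<^sub>R (((**) E) ^^ k) (mat 1))"

definition mat_powr :: "real \<Rightarrow> real ^ 'd ^ 'd \<Rightarrow> real ^ 'd ^ 'd" where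
  "mat_powr t E = mat_exp (ln t *\<^sub>R E)"

definition Expo :: "(real ^ 'd \<Rightarrow> complex) \<Rightarrow> (real ^ 'd ^ 'd) set" where
  "Expo P = {E. \<forall>t>0. \<forall>\<xi>. complex_of_real t * P \<xi> = P (mat_powr t E *v \<xi>)}"

(* The spectrum consists of the eigenvalues of E over the complex numbers. *)
definition real_spectrum :: "real ^ 'd ^ 'd \<Rightarrow> bool" where
  "real_spectrum E \<longleftrightarrow>
     (\<forall>(c::complex) (v::complex ^ 'd). v \<noteq> 0 \<and> map_matrix complex_of_real E *v v = c *s v \<longrightarrow> c \<in> \<real>)"

definition positive_homogeneous :: "(real ^ 'd \<Rightarrow> complex) \<Rightarrow> bool" where
  "positive_homogeneous P \<longleftrightarrow>
     continuous_on UNIV P \<and>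
     (\<forall>\<xi>. Re (P \<xi>) \<ge> 0) \<and> (\<forall>\<xi>. Re (P \<xi>) = 0 \<longrightarrow> \<xi> = 0) \<and>
     (\<exists>E \<in> Expo P. real_spectrum E)"

(* For positive homogeneous P the trace does not depend on the chosen exponent. *)
definition hom_order :: "(real ^ 'd \<Rightarrow> complex) \<Rightarrow> real" where
  "hom_order P = trace (SOME E. E \<in> Expo P)"

definition heat_kernel :: "(real ^ 'd \<Rightarrow> complex) \<Rightarrow> real \<Rightarrow> real ^ 'd \<Rightarrow> complex" where
  "heat_kernel P t x = 1 / (2 * complex_of_real pi) ^ CARD('d) *
     (LINT \<xi>|lborel. exp (- complex_of_real t * P \<xi>) * exp (- \<i> * complex_of_real (x \<bullet> \<xi>)))"

definition Omega :: "(int ^ 'd \<Rightarrow> complex) \<Rightarrow> (real ^ 'd) set" where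
  "Omega \<phi> = {\<xi> \<in> torus. norm (fourier \<phi> \<xi>) = 1}"

(* Ln is the principal branch (total, with Im in (-pi, pi]); only values near 0 are ever used. *)
definition Gam :: "(int ^ 'd \<Rightarrow> complex) \<Rightarrow> real ^ 'd \<Rightarrow> real ^ 'd \<Rightarrow> complex" where
  "Gam \<phi> \<xi>\<^sub>0 \<xi> = Ln (fourier \<phi> (\<xi> + \<xi>\<^sub>0) / fourier \<phi> \<xi>\<^sub>0)"

(* The remainder Upsilon is the difference of Gam and the terms i alpha.xi - P(xi).  A complex
   polynomial in d real variables is a polynomial_function from R^d to the complex numbers. *)
definition pos_hom_expansion ::
    "(int ^ 'd \<Rightarrow> complex) \<Rightarrow> real ^ 'd \<Rightarrow> real ^ 'd \<Rightarrow> (real ^ 'd \<Rightarrow> complex) \<Rightarrow> bool" where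
  "pos_hom_expansion \<phi> \<xi>\<^sub>0 \<alpha> P \<longleftrightarrow>
     polynomial_function P \<and> positive_homogeneous P \<and>
     (\<lambda>\<xi>. Gam \<phi> \<xi>\<^sub>0 \<xi> - (\<i> * complex_of_real (\<alpha> \<bullet> \<xi>) - P \<xi>))
       \<in> o[at 0](\<lambda>\<xi>. complex_of_real (Re (P \<xi>)))"

definition pos_hom_type :: "(int ^ 'd \<Rightarrow> complex) \<Rightarrow> real ^ 'd \<Rightarrow> bool" where
  "pos_hom_type \<phi> \<xi>\<^sub>0 \<longleftrightarrow> (\<exists>\<alpha> P. pos_hom_expansion \<phi> \<xi>\<^sub>0 \<alpha> P)"

(* The pair (alpha, P) is unique at a point of positive homogeneous type. *)
definition drift_poly :: "(int ^ 'd \<Rightarrow> complex) \<Rightarrow> real ^ 'd \<Rightarrow> (real ^ 'd) \<times> (real ^ 'd \<Rightarrow> complex)" where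
  "drift_poly \<phi> \<xi>\<^sub>0 = (SOME (\<alpha>, P). pos_hom_expansion \<phi> \<xi>\<^sub>0 \<alpha> P)"

definition drift :: "(int ^ 'd \<Rightarrow> complex) \<Rightarrow> real ^ 'd \<Rightarrow> real ^ 'd" where
  "drift \<phi> \<xi>\<^sub>0 = fst (drift_poly \<phi> \<xi>\<^sub>0)"

definition hom_poly :: "(int ^ 'd \<Rightarrow> complex) \<Rightarrow> real ^ 'd \<Rightarrow> real ^ 'd \<Rightarrow> complex" where
  "hom_poly \<phi> \<xi>\<^sub>0 = snd (drift_poly \<phi> \<xi>\<^sub>0)"

(* Omega \<phi> is finite and nonempty whenever mu is used, so Min is the minimum. *)
definition mu :: "(int ^ 'd \<Rightarrow> complex) \<Rightarrow> real" where
  "mu \<phi> = Min ((\<lambda>\<xi>. hom_order (hom_poly \<phi> \<xi>)) ` Omega \<phi>)"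

end

theory Submission
  imports Defs "HOL-Real_Asymp.Real_Asymp"
begin

text \<open>
  Fourier inversion writes \<open>(2 \<pi>)^d \<phi>^(n)(x)\<close> as the integral of
  \<open>f(\<xi>)^n e^(-i x \<cdot> \<xi>)\<close> over a cube of side \<open>2 \<pi>\<close>, where \<open>f\<close> is the Fourier
  transform of \<open>\<phi>\<close> (\<open>conv_power_eq_integral\<close>).  The integrand decays exponentially in \<open>n\<close> away from
  the points where \<open>|f| = 1\<close>.  The hypothesis on these points makes them isolated: near such a point
  \<open>\<eta>\<close> the modulus of \<open>f\<close> is at most \<open>exp(- R / 2)\<close>, where \<open>R = Re P\<close> is evaluated at the
  displacement from \<open>\<eta>\<close>.  By compactness \<open>Omega \<phi>\<close> is finite, and the cube can be placed so that it
  meets the set \<open>|f| = 1\<close> exactly in \<open>Omega \<phi>\<close>, with all these points in its interior.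

  On a small ball about \<open>\<eta>\<close> one has, up to the factor \<open>f(\<eta>)^n e^(-i x \<cdot> \<eta>)\<close>, the integral of
  \<open>exp(n (i \<alpha> \<cdot> \<xi> - P(\<xi>) + \<Upsilon>(\<xi>))) e^(-i x \<cdot> \<xi>)\<close>; without \<open>\<Upsilon>\<close> and over all of space this is
  \<open>(2 \<pi>)^d H_P^n(x - n \<alpha>)\<close>.  The difference of the two is bounded by the integral of the modulus of the
  difference of the integrands, in which \<open>x\<close> no longer occurs; this is where uniformity in \<open>x\<close> comes
  from.  The substitution \<open>\<xi> = n^(-E) \<zeta>\<close> with \<open>E\<close> in \<open>Expo P\<close> has Jacobian
  \<open>det n^(-E) = n^(- tr E)\<close> and turns \<open>n R(\<xi>)\<close> into \<open>R(\<zeta>)\<close>, so that dominated convergence with majorant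
  \<open>2 exp(- R / 2)\<close> gives \<open>o(n^(- tr E))\<close> (\<open>discrepancy_integral_tendsto_0\<close>).

  Two facts about \<open>P\<close> feed the dominated convergence: \<open>n^(-E) \<zeta>\<close> tends to \<open>0\<close>, and \<open>exp(- c R)\<close> is
  integrable for every \<open>c > 0\<close>.  Both follow from one observation (\<open>flow_expands\<close>).  On the unit
  sphere \<open>R\<close> has a positive minimum, so \<open>R(t^E u) = t R(u)\<close> is large, uniformly in the unit vector
  \<open>u\<close>, when \<open>t\<close> is large; since \<open>R\<close> is bounded on bounded sets, \<open>t^E\<close> stretches all unit vectors by a
  large factor, and its inverse is a strong contraction.

  Points of \<open>Omega \<phi>\<close> whose order exceeds \<open>mu \<phi>\<close> contribute a heat kernel of size
  \<open>O(n^(- tr E))\<close>, again by scaling, which is \<open>o(n^(-\<mu>))\<close>.  The order of \<open>P\<close> is the trace of one chosen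
  exponent, and the substitution above is made with that same exponent.
\<close>

section \<open>Matrix exponentials\<close>

lemma mat_pow_entry_bound:
  fixes E :: "real^'d^'d"
  shows "\<bar>((((**) E) ^^ k) (mat 1)) $ i $ j\<bar> \<le> (\<Sum>i\<in>UNIV. \<Sum>l\<in>UNIV. \<bar>E $ i $ l\<bar>) ^ k"
proof (induction k arbitrary: i j)
  case 0
  show ?case by (simp add: mat_def)
next
  case (Suc k)
  let ?K = "\<Sum>i\<in>UNIV. \<Sum>l\<in>UNIV. \<bar>E $ i $ l\<bar>"
  have "\<bar>((((**) E) ^^ Suc k) (mat 1)) $ i $ j\<bar>
      = \<bar>\<Sum>l\<in>UNIV. E $ i $ l * ((((**) E) ^^ k) (mat 1)) $ l $ j\<bar>"
    by (simp add: matrix_matrix_mult_def)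
  also have "\<dots> \<le> (\<Sum>l\<in>UNIV. \<bar>E $ i $ l\<bar> * ?K ^ k)"
    by (rule order_trans[OF sum_abs]) (auto intro!: sum_mono mult_left_mono Suc.IH simp: abs_mult)
  also have "\<dots> = (\<Sum>l\<in>UNIV. \<bar>E $ i $ l\<bar>) * ?K ^ k"
    by (simp add: sum_distrib_right)
  also have "\<dots> \<le> ?K * ?K ^ k"
    by (intro mult_right_mono zero_le_power sum_nonneg member_le_sum) (auto simp: sum_nonneg)
  finally show ?case by simp
qed

lemma mat_pow_scaleR:
  fixes E :: "real^'d^'d"
  shows "(((**) (t *\<^sub>R E)) ^^ k) (mat 1) = t ^ k *\<^sub>R (((**) E) ^^ k) (mat 1)"
  by (induction k) (simp_all add: scalar_matrix_assoc [symmetric] matrix_scalar_ac)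

lemma mat_pow_Suc_right:
  fixes E :: "real^'d^'d"
  shows "(((**) E) ^^ Suc k) (mat 1) = (((**) E) ^^ k) (mat 1) ** E"
  by (induction k) (simp_all add: matrix_mul_assoc)

lemma exp_series_entry_summable:
  fixes E :: "real^'d^'d"
  shows "summable (\<lambda>k. (((((**) E) ^^ k) (mat 1)) $ i $ j / fact k) * t ^ k)"
proof (rule summable_comparison_test')
  let ?K = "\<Sum>i\<in>UNIV. \<Sum>l\<in>UNIV. \<bar>E $ i $ l\<bar>"
  show "summable (\<lambda>k. (?K * \<bar>t\<bar>) ^ k /\<^sub>R fact k)"
    by (rule summable_exp_generic)
  fix k
  have "norm ((((((**) E) ^^ k) (mat 1)) $ i $ j / fact k) * t ^ k)
      = \<bar>((((**) E) ^^ k) (mat 1)) $ i $ j\<bar> * (\<bar>t\<bar> ^ k / fact k)"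
    by (simp add: abs_mult power_abs)
  also have "\<dots> \<le> ?K ^ k * (\<bar>t\<bar> ^ k / fact k)"
    by (intro mult_right_mono mat_pow_entry_bound) auto
  finally show "norm ((((((**) E) ^^ k) (mat 1)) $ i $ j / fact k) * t ^ k) \<le> (?K * \<bar>t\<bar>) ^ k /\<^sub>R fact k"
    by (simp add: power_mult_distrib field_simps)
qed

text \<open>
  The exponential is handled entry by entry: along the line spanned by \<open>E\<close> each entry is an
  everywhere convergent real power series, which makes termwise differentiation available.
\<close>

lemma mat_exp_entry:
  fixes E :: "real^'d^'d"
  shows "mat_exp (t *\<^sub>R E) $ i $ j = (\<Sum>k. (((((**) E) ^^ k) (mat 1)) $ i $ j / fact k) * t ^ k)"
proof -
  let ?B = "\<lambda>k. (((**) E) ^^ k) (mat 1)"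
  let ?S = "\<chi> i j. (\<Sum>k. (?B k $ i $ j / fact k) * t ^ k)"
  have "(\<lambda>k. (1 / fact k) *\<^sub>R (((**) (t *\<^sub>R E)) ^^ k) (mat 1)) sums ?S"
    unfolding sums_def
    by (intro vec_tendstoI) (use exp_series_entry_summable[of E] in
      \<open>simp add: mat_pow_scaleR sums_def[symmetric] mult.commute summable_sums\<close>)
  then show ?thesis
    unfolding mat_exp_def by (simp add: sums_iff)
qed

lemma mat_exp_0: "mat_exp (0 :: real^'d^'d) = mat 1"
proof -
  have "mat_exp (0 :: real^'d^'d) $ i $ j = mat 1 $ i $ j" for i j
    using mat_exp_entry[of 0 0 i j] unfolding powser_zero by simp
  then show ?thesis by (simp add: vec_eq_iff)
qed

text \<open>
  Termwise differentiation shifts the powers of \<open>E\<close> by one.  The extra factor can be split off on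
  either side, and both forms are needed for the group law.
\<close>

lemma DERIV_mat_exp_entry:
  fixes E :: "real^'d^'d"
  shows "((\<lambda>t. mat_exp (t *\<^sub>R E) $ i $ j) has_field_derivative
           (\<Sum>l\<in>UNIV. mat_exp (t *\<^sub>R E) $ i $ l * E $ l $ j)) (at t)"
    and "((\<lambda>t. mat_exp (t *\<^sub>R E) $ i $ j) has_field_derivative
           (\<Sum>l\<in>UNIV. E $ i $ l * mat_exp (t *\<^sub>R E) $ l $ j)) (at t)"
proof -
  let ?B = "\<lambda>k. (((**) E) ^^ k) (mat 1)"
  let ?c = "\<lambda>i j k. ?B k $ i $ j / fact k"
  have D: "((\<lambda>t. mat_exp (t *\<^sub>R E) $ i $ j) has_field_derivative (\<Sum>k. diffs (?c i j) k * t ^ k)) (at t)"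
    unfolding mat_exp_entry
    by (rule termdiffs_strong_converges_everywhere) (rule exp_series_entry_summable)
  have d: "diffs (?c i j) k = ?B (Suc k) $ i $ j / fact k" for k
    by (simp add: diffs_def field_simps del: funpow.simps of_nat_Suc)
  have "(\<Sum>k. diffs (?c i j) k * t ^ k) = (\<Sum>k. \<Sum>l\<in>UNIV. (?c i l k * t ^ k) * E $ l $ j)"
    unfolding d mat_pow_Suc_right
    by (intro suminf_cong) (simp add: matrix_matrix_mult_def sum_divide_distrib sum_distrib_left mult_ac)
  also have "\<dots> = (\<Sum>l\<in>UNIV. \<Sum>k. (?c i l k * t ^ k) * E $ l $ j)"
    by (rule suminf_sum) (rule summable_mult2[OF exp_series_entry_summable])
  also have "\<dots> = (\<Sum>l\<in>UNIV. mat_exp (t *\<^sub>R E) $ i $ l * E $ l $ j)"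
    unfolding mat_exp_entry by (intro sum.cong refl suminf_mult2[symmetric] exp_series_entry_summable)
  finally show "((\<lambda>t. mat_exp (t *\<^sub>R E) $ i $ j) has_field_derivative
           (\<Sum>l\<in>UNIV. mat_exp (t *\<^sub>R E) $ i $ l * E $ l $ j)) (at t)" using D by simp
  have "(\<Sum>k. diffs (?c i j) k * t ^ k) = (\<Sum>k. \<Sum>l\<in>UNIV. E $ i $ l * (?c l j k * t ^ k))"
    unfolding d
    by (intro suminf_cong) (simp add: matrix_matrix_mult_def sum_divide_distrib sum_distrib_left mult_ac)
  also have "\<dots> = (\<Sum>l\<in>UNIV. \<Sum>k. E $ i $ l * (?c l j k * t ^ k))"
    by (rule suminf_sum) (rule summable_mult[OF exp_series_entry_summable])
  also have "\<dots> = (\<Sum>l\<in>UNIV. E $ i $ l * mat_exp (t *\<^sub>R E) $ l $ j)"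
    unfolding mat_exp_entry by (intro sum.cong refl suminf_mult exp_series_entry_summable)
  finally show "((\<lambda>t. mat_exp (t *\<^sub>R E) $ i $ j) has_field_derivative
           (\<Sum>l\<in>UNIV. E $ i $ l * mat_exp (t *\<^sub>R E) $ l $ j)) (at t)" using D by simp
qed

text \<open>
  The entries of \<open>e^((s+t)E) e^(-tE)\<close> have derivative zero in \<open>t\<close>: differentiating the two factors
  puts the extra \<open>E\<close> in the middle with opposite signs.  Inverses and the group law both follow.
\<close>

lemma mat_exp_shift:
  fixes E :: "real^'d^'d"
  shows "mat_exp ((s + t) *\<^sub>R E) ** mat_exp ((- t) *\<^sub>R E) = mat_exp (s *\<^sub>R E)"
proof -
  let ?m = "\<lambda>t. mat_exp (t *\<^sub>R E)"
  let ?N = "\<lambda>i j t. \<Sum>l\<in>UNIV. ?m (s + t) $ i $ l * ?m (- t) $ l $ j"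
  have D: "(?N i j has_field_derivative 0) (at t)" for i j t
  proof -
    have 1: "((\<lambda>t. ?m (s + t) $ i $ l) has_field_derivative (\<Sum>p\<in>UNIV. ?m (s + t) $ i $ p * E $ p $ l)) (at t)" for l
      using DERIV_mat_exp_entry(1)[of E i l "s + t"]
      by (simp add: DERIV_shift add.commute[of s])
    have 2: "((\<lambda>t. ?m (- t) $ l $ j) has_field_derivative - (\<Sum>p\<in>UNIV. E $ l $ p * ?m (- t) $ p $ j)) (at t)" for l
      using DERIV_mat_exp_entry(2)[of E l j "- t"] by (simp add: DERIV_mirror)
    have "(?N i j has_field_derivative (\<Sum>l\<in>UNIV. (\<Sum>p\<in>UNIV. ?m (s + t) $ i $ p * E $ p $ l) * ?m (- t) $ l $ j
        + - (\<Sum>p\<in>UNIV. E $ l $ p * ?m (- t) $ p $ j) * ?m (s + t) $ i $ l)) (at t)"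
      by (intro DERIV_sum DERIV_mult 1 2)
    moreover have "(\<Sum>l\<in>UNIV. (\<Sum>p\<in>UNIV. ?m (s + t) $ i $ p * E $ p $ l) * ?m (- t) $ l $ j)
      = (\<Sum>l\<in>UNIV. (\<Sum>p\<in>UNIV. E $ l $ p * ?m (- t) $ p $ j) * ?m (s + t) $ i $ l)"
      by (simp add: sum_distrib_right, subst sum.swap) (simp add: mult_ac)
    ultimately show ?thesis by (simp add: sum.distrib sum_negf sum_subtractf)
  qed
  have "?N i j t = ?N i j 0" for i j
    using DERIV_isconst_all[of "?N i j"] D by blast
  then show ?thesis
    by (simp add: vec_eq_iff matrix_matrix_mult_def mat_exp_0) (simp add: mat_def mult.commute[of _ "if _ then _ else _"] if_distrib[of "\<lambda>x. x * _"] cong: if_cong)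
qed

lemma mat_exp_inverse:
  fixes E :: "real^'d^'d"
  shows "mat_exp (t *\<^sub>R E) ** mat_exp ((- t) *\<^sub>R E) = mat 1"
  using mat_exp_shift[of 0 t E] by (simp add: mat_exp_0)

lemma mat_exp_add:
  fixes E :: "real^'d^'d"
  shows "mat_exp ((s + t) *\<^sub>R E) = mat_exp (s *\<^sub>R E) ** mat_exp (t *\<^sub>R E)"
  using mat_exp_shift[of "s + t" "-t" E] by simp

text \<open>
  At \<open>t = 0\<close> the matrix is the identity, so after one factor of a permutation term is
  differentiated the remaining product vanishes unless the permutation is the identity; what is left
  is the sum of the diagonal entries of \<open>E\<close>.
\<close>

lemma DERIV_det_mat_exp_0:
  fixes E :: "real^'d^'d"
  shows "((\<lambda>t. det (mat_exp (t *\<^sub>R E))) has_field_derivative trace E) (at 0)"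
proof -
  let ?m = "\<lambda>t. mat_exp (t *\<^sub>R E)"
  have d: "((\<lambda>t. ?m t $ i $ j) has_field_derivative E $ i $ j) (at 0)" for i j
    using DERIV_mat_exp_entry(1)[of E i j 0]
    by (simp add: mat_exp_0) (simp add: mat_def if_distrib[of "\<lambda>x. x * _"] cong: if_cong)
  have z: "(\<Prod>j\<in>UNIV - {i}. mat 1 $ j $ p j :: real) = (if p = id then 1 else 0)" if p: "p permutes UNIV" for p and i :: 'd
  proof (cases "p = id")
    case True then show ?thesis by (simp add: mat_def)
  next
    case False
    have "\<exists>j. j \<noteq> i \<and> p j \<noteq> j"
    proof (rule ccontr)
      assume "\<not> ?thesis"
      then have a: "\<And>j. j \<noteq> i \<Longrightarrow> p j = j" by blast
      moreover have "p i = i"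
        using a permutes_inj[OF p] by (metis injD)
      ultimately show False using False by (metis eq_id_iff)
    qed
    then obtain j where "j \<noteq> i" "p j \<noteq> j" by blast
    then show ?thesis using False by (auto intro!: prod_zero bexI[of _ j] simp: mat_def)
  qed
  have "((\<lambda>t. det (?m t)) has_field_derivative
      (\<Sum>p\<in>{p. p permutes UNIV}. of_int (sign p) * (\<Sum>i\<in>UNIV. E $ i $ p i * (\<Prod>j\<in>UNIV - {i}. ?m 0 $ j $ p j)))) (at 0)"
    unfolding det_def
    by (intro DERIV_sum DERIV_cmult has_field_derivative_prod d)
  also have "(\<Sum>p\<in>{p. p permutes UNIV}. of_int (sign p) * (\<Sum>i\<in>UNIV. E $ i $ p i * (\<Prod>j\<in>UNIV - {i}. ?m 0 $ j $ p j)))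
     = (\<Sum>p\<in>{p. p permutes (UNIV::'d set)}. if p = id then trace E else 0)"
    by (intro sum.cong refl) (auto simp: mat_exp_0 z trace_def)
  also have "\<dots> = trace E" by (simp add: permutes_id finite_permutations)
  finally show ?thesis .
qed

text \<open>
  By the group law the determinant is multiplicative in \<open>t\<close>, so its derivative at any \<open>t\<close> is its
  value there times the trace.
\<close>

lemma det_mat_exp:
  fixes E :: "real^'d^'d"
  shows "det (mat_exp (t *\<^sub>R E)) = exp (t * trace E)"
proof -
  let ?D = "\<lambda>t. det (mat_exp (t *\<^sub>R E))"
  have D: "(?D has_field_derivative ?D t * trace E) (at t)" for t
  proof -
    have "((\<lambda>h. ?D t * ?D h) has_field_derivative ?D t * trace E) (at 0)"
      by (intro DERIV_cmult DERIV_det_mat_exp_0)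
    moreover have "(\<lambda>h. ?D t * ?D h) = (\<lambda>h. ?D (t + h))"
      by (simp only: mat_exp_add det_mul)
    ultimately show ?thesis using DERIV_shift[of ?D "?D t * trace E" 0 t]
      by (simp add: add.commute)
  qed
  have "((\<lambda>t. ?D t * exp (- (t * trace E))) has_field_derivative 0) (at t)" for t
    by (rule derivative_eq_intros D refl | simp)+
  then have "?D t * exp (- (t * trace E)) = ?D 0 * exp (- (0 * trace E))"
    using DERIV_isconst_all by blast
  then show ?thesis by (simp add: mat_exp_0 exp_minus field_simps)
qed

section \<open>Linear substitution in Lebesgue integrals\<close>

lemma Basis_vec_real: "(Basis :: (real^'n) set) = range (\<lambda>i. axis i 1)"
  by (auto simp: Basis_vec_def)

lemma axis_nth: "axis k x $ i = (if i = k then x else 0)"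
  by (simp add: axis_def)

lemma prod_Basis_vec:
  fixes f :: "real^'n \<Rightarrow> 'b::comm_monoid_mult"
  shows "(\<Prod>b\<in>Basis. f b) = (\<Prod>i\<in>UNIV. f (axis i 1))"
  unfolding Basis_vec_real by (subst prod.reindex) (auto simp: inj_on_def axis_eq_axis)

text \<open>
  With the coordinate along \<open>b1\<close> integrated first, a shear in direction \<open>b1\<close> only translates the
  inner integral.
\<close>

lemma nn_integral_lborel_shear:
  fixes b1 b2 :: "'a::euclidean_space"
  assumes b: "b1 \<in> Basis" "b2 \<in> Basis" "b1 \<noteq> b2" and [measurable]: "g \<in> borel_measurable borel"
  shows "(\<integral>\<^sup>+v. g (v + (v \<bullet> b2) *\<^sub>R b1) \<partial>lborel) = (\<integral>\<^sup>+v. g v \<partial>lborel)"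
proof -
  interpret product_sigma_finite "\<lambda>_::'a. lborel :: real measure" by unfold_locales
  define I where "I = (Basis :: 'a set) - {b1}"
  have I: "insert b1 I = Basis" "b1 \<notin> I" "finite I" "b2 \<in> I"
    using b by (auto simp: I_def)
  let ?S = "\<lambda>f. \<Sum>b\<in>Basis. f b *\<^sub>R (b::'a)"
  have eq: "(\<integral>\<^sup>+v. h v \<partial>lborel) = (\<integral>\<^sup>+x. \<integral>\<^sup>+y. h (?S (x(b1 := y))) \<partial>lborel \<partial>(\<Pi>\<^sub>M b\<in>I. lborel))"
    if [measurable]: "h \<in> borel_measurable borel" for h :: "'a \<Rightarrow> ennreal"
  proof -
    have "(\<integral>\<^sup>+v. h v \<partial>lborel) = (\<integral>\<^sup>+x. h (?S x) \<partial>(\<Pi>\<^sub>M b\<in>Basis. lborel))"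
      by (subst lborel_eq) (simp add: nn_integral_distr)
    also have "\<dots> = (\<integral>\<^sup>+x. h (?S x) \<partial>(\<Pi>\<^sub>M b\<in>insert b1 I. lborel))"
      by (simp only: I)
    also have "\<dots> = (\<integral>\<^sup>+x. \<integral>\<^sup>+y. h (?S (x(b1 := y))) \<partial>lborel \<partial>(\<Pi>\<^sub>M b\<in>I. lborel))"
      using I by (intro product_nn_integral_insert) (auto simp: I(1))
    finally show ?thesis .
  qed
  have S: "?S (x(b1 := y)) = (\<Sum>b\<in>I. x b *\<^sub>R b) + y *\<^sub>R b1" for x y
  proof -
    have "?S (x(b1 := y)) = (\<Sum>b\<in>insert b1 I. (x(b1 := y)) b *\<^sub>R b)" by (simp only: I)
    also have "\<dots> = y *\<^sub>R b1 + (\<Sum>b\<in>I. (x(b1 := y)) b *\<^sub>R b)"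
      using I(2,3) by (subst sum.insert) auto
    also have "(\<Sum>b\<in>I. (x(b1 := y)) b *\<^sub>R b) = (\<Sum>b\<in>I. x b *\<^sub>R b)"
      using I by (intro sum.cong) auto
    finally show ?thesis by (simp add: add.commute)
  qed
  have S2: "?S (x(b1 := y)) \<bullet> b2 = x b2" for x y
    proof -
    have "?S (x(b1 := y)) \<bullet> b2 = (\<Sum>b\<in>Basis. (if b = b2 then x b2 else 0))"
      unfolding inner_sum_left using b by (intro sum.cong) (auto simp: inner_Basis)
    then show ?thesis using b by simp
  qed
  have sh: "?S (x(b1 := y)) + (?S (x(b1 := y)) \<bullet> b2) *\<^sub>R b1 = ?S (x(b1 := x b2 + y))" for x y
    unfolding S2 unfolding S by (simp add: scaleR_add_left)
  have "(\<integral>\<^sup>+v. g (v + (v \<bullet> b2) *\<^sub>R b1) \<partial>lborel)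
      = (\<integral>\<^sup>+x. \<integral>\<^sup>+y. g (?S (x(b1 := x b2 + y))) \<partial>lborel \<partial>(\<Pi>\<^sub>M b\<in>I. lborel))"
    proof -
    have m: "(\<lambda>v. g (v + (v \<bullet> b2) *\<^sub>R b1)) \<in> borel_measurable borel" by measurable
    show ?thesis by (simp only: eq[OF m] sh)
  qed
  also have "\<dots> = (\<integral>\<^sup>+x. \<integral>\<^sup>+y. g (?S (x(b1 := y))) \<partial>lborel \<partial>(\<Pi>\<^sub>M b\<in>I. lborel))"
  proof (rule nn_integral_cong)
    fix x :: "'a \<Rightarrow> real"
    show "(\<integral>\<^sup>+y. g (?S (x(b1 := x b2 + y))) \<partial>lborel) = (\<integral>\<^sup>+y. g (?S (x(b1 := y))) \<partial>lborel)"
      unfolding S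
      by (subst (2) lborel_distr_plus[symmetric, of "x b2"]) (simp add: nn_integral_distr)
  qed
  also have "\<dots> = (\<integral>\<^sup>+v. g v \<partial>lborel)"
    by (rule eq[symmetric]) simp
  finally show ?thesis .
qed

text \<open>
  Both sides behave multiplicatively under products of matrices, so it suffices to treat elementary
  matrices: diagonal scalings, coordinate swaps and shears.  Non-invertible factors cannot occur in an
  invertible product.
\<close>

lemma nn_integral_lborel_linear:
  fixes M :: "real^'d^'d"
  assumes "det M \<noteq> 0" and "g \<in> borel_measurable borel"
  shows "(\<integral>\<^sup>+\<xi>. g \<xi> \<partial>lborel) = ennreal \<bar>det M\<bar> * (\<integral>\<^sup>+\<xi>. g (M *v \<xi>) \<partial>lborel)"
proof -
  have [measurable]: "(*v) A \<in> borel_measurable borel" for A :: "real^'d^'d"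
    by (intro borel_measurable_continuous_onI matrix_vector_mult_linear_continuous_on)
  have "det M \<noteq> 0 \<longrightarrow> (\<forall>g\<in>borel_measurable borel.
      (\<integral>\<^sup>+\<xi>. g \<xi> \<partial>lborel) = ennreal \<bar>det M\<bar> * (\<integral>\<^sup>+\<xi>. g (M *v \<xi>) \<partial>lborel))" (is "?P M")
  proof (rule induct_matrix_elementary_alt[where P = ?P])
    fix A B :: "real^'d^'d"
    assume A: "?P A" and B: "?P B"
    show "?P (A ** B)"
    proof (intro impI ballI)
      fix g :: "real^'d \<Rightarrow> ennreal" assume [measurable]: "g \<in> borel_measurable borel"
      assume "det (A ** B) \<noteq> 0"
      then have d: "det A \<noteq> 0" "det B \<noteq> 0" by (auto simp: det_mul)
      have "(\<integral>\<^sup>+\<xi>. g \<xi> \<partial>lborel) = ennreal \<bar>det A\<bar> * (\<integral>\<^sup>+\<xi>. g (A *v \<xi>) \<partial>lborel)"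
        by (rule A[rule_format, OF d(1)]) simp
      also have "(\<integral>\<^sup>+\<xi>. g (A *v \<xi>) \<partial>lborel) = ennreal \<bar>det B\<bar> * (\<integral>\<^sup>+\<xi>. g (A *v (B *v \<xi>)) \<partial>lborel)"
        by (rule B[rule_format, OF d(2)]) measurable
      finally show "(\<integral>\<^sup>+\<xi>. g \<xi> \<partial>lborel) = ennreal \<bar>det (A ** B)\<bar> * (\<integral>\<^sup>+\<xi>. g ((A ** B) *v \<xi>) \<partial>lborel)"
        by (simp add: det_mul abs_mult ennreal_mult' mult.assoc matrix_vector_mul_assoc)
    qed
  next
    fix A :: "real^'d^'d" and i assume "row i A = 0"
    then show "?P A" using det_zero_row(2)[of i A] by simp
  next
    fix A :: "real^'d^'d" assume D: "\<And>i j. i \<noteq> j \<Longrightarrow> A $ i $ j = 0"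
    define c where "c b = b \<bullet> (A *v b)" for b :: "real^'d"
    have ca: "c (axis i 1) = A $ i $ i" for i
      by (simp add: c_def inner_axis' matrix_vector_mul_component inner_axis)
    show "?P A"
    proof (intro impI ballI)
      fix g :: "real^'d \<Rightarrow> ennreal" assume [measurable]: "g \<in> borel_measurable borel"
      assume dn: "det A \<noteq> 0"
      have dA: "det A = (\<Prod>i\<in>UNIV. A $ i $ i)" using D by (rule det_diagonal)
      have nz: "c b \<noteq> 0" if "b \<in> Basis" for b
        using that dn by (auto simp: Basis_vec_real ca dA)
      have T: "(\<lambda>x. 0 + (\<Sum>j\<in>Basis. (c j * (x \<bullet> j)) *\<^sub>R j)) = (*v) A"
      proof (intro ext vec_eq_iff[THEN iffD2] allI)
        fix x :: "real^'d" and i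
        have "(A *v x) $ i = (\<Sum>j\<in>UNIV. A $ i $ j * x $ j)" by (simp add: matrix_vector_mult_def)
        also have "\<dots> = (\<Sum>j\<in>UNIV. if j = i then A $ i $ i * x $ i else 0)"
          using D by (intro sum.cong) auto
        finally have "(A *v x) $ i = A $ i $ i * x $ i" by simp
        moreover have "(0 + (\<Sum>j\<in>Basis. (c j * (x \<bullet> j)) *\<^sub>R j)) $ i = A $ i $ i * x $ i"
        proof -
          have "(0 + (\<Sum>j\<in>Basis. (c j * (x \<bullet> j)) *\<^sub>R j)) $ i
              = (\<Sum>j\<in>(Basis :: (real^'d) set). if j = axis i 1 then A $ i $ i * x $ i else 0)"
            unfolding add_0 sum_component
            by (rule sum.cong[OF refl]) (auto simp: Basis_vec_real ca axis_eq_axis inner_axis axis_nth)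
          then show ?thesis by (simp add: Basis_vec_real)
        qed
        ultimately show "(0 + (\<Sum>j\<in>Basis. (c j * (x \<bullet> j)) *\<^sub>R j)) $ i = (A *v x) $ i" by simp
      qed
      have "lborel = density (distr lborel borel ((*v) A)) (\<lambda>_. (\<Prod>j\<in>Basis. \<bar>c j\<bar>))"
        using lborel_affine_euclidean[where c = c and t = 0] nz unfolding T by simp
      also have "(\<Prod>j\<in>Basis. \<bar>c j\<bar>) = \<bar>det A\<bar>"
        by (simp add: prod_Basis_vec ca dA abs_prod)
      finally have L: "lborel = density (distr lborel borel ((*v) A)) (\<lambda>_. ennreal \<bar>det A\<bar>)" .
      show "(\<integral>\<^sup>+\<xi>. g \<xi> \<partial>lborel) = ennreal \<bar>det A\<bar> * (\<integral>\<^sup>+\<xi>. g (A *v \<xi>) \<partial>lborel)"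
        by (subst L) (simp add: nn_integral_density nn_integral_distr nn_integral_cmult)
    qed
  next
    fix m n :: 'd assume mn: "m \<noteq> n"
    let ?t = "Transposition.transpose m n"
    let ?A = "(\<chi> i j. mat 1 $ i $ ?t j) :: real^'d^'d"
    have pt: "?t permutes UNIV" by (simp add: permutes_swap_id)
    have dA: "\<bar>det ?A\<bar> = 1"
      using det_permute_columns[OF pt, of "mat 1 :: real^'d^'d"] by (simp add: sign_def)
    have A: "(?A *v v) $ i = v $ ?t i" for v i
    proof -
      have "(?A *v v) $ i = (\<Sum>j\<in>UNIV. if j = ?t i then v $ j else 0)"
        unfolding matrix_vector_mult_def mat_def vec_lambda_beta
        by (rule sum.cong[OF refl]) (auto simp: transpose_eq_iff)
      also have "\<dots> = v $ ?t i" by simp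
      finally show ?thesis .
    qed
    have L: "lborel = distr lborel borel ((*v) ?A)"
    proof (rule lborel_eqI)
      fix l u :: "real^'d" assume lu: "\<And>b. b \<in> Basis \<Longrightarrow> l \<bullet> b \<le> u \<bullet> b"
      have lu': "l $ i \<le> u $ i" for i
        using lu[of "axis i 1"] by (simp add: Basis_vec_real inner_axis)
      have "(*v) ?A -` box l u = box (?A *v l) (?A *v u)"
        by (auto simp: mem_box_cart A) (metis Transposition.transpose_involutory)+
      then have "emeasure (distr lborel borel ((*v) ?A)) (box l u) = emeasure lborel (box (?A *v l) (?A *v u))"
        by (simp add: emeasure_distr)
      also have "\<dots> = ennreal (\<Prod>i\<in>UNIV. (u - l) $ ?t i)"
      proof (subst emeasure_lborel_box)
        show "(?A *v l) \<bullet> b \<le> (?A *v u) \<bullet> b" if "b \<in> Basis" for b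
          using that lu' by (auto simp: Basis_vec_real inner_axis A)
      qed (simp add: prod_Basis_vec inner_axis A)
      also have "(\<Prod>i\<in>UNIV. (u - l) $ ?t i) = (\<Prod>i\<in>UNIV. (u - l) $ i)"
        using prod.permute[OF pt, of "\<lambda>i. (u - l) $ i"] by (simp add: o_def)
      finally show "emeasure (distr lborel borel ((*v) ?A)) (box l u) = ennreal (\<Prod>b\<in>Basis. (u - l) \<bullet> b)"
        by (simp add: prod_Basis_vec inner_axis)
    qed simp
    show "?P ?A"
    proof (intro impI ballI)
      fix g :: "real^'d \<Rightarrow> ennreal" assume [measurable]: "g \<in> borel_measurable borel"
      show "(\<integral>\<^sup>+\<xi>. g \<xi> \<partial>lborel) = ennreal \<bar>det ?A\<bar> * (\<integral>\<^sup>+\<xi>. g (?A *v \<xi>) \<partial>lborel)"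
        unfolding dA by (subst L) (simp add: nn_integral_distr)
    qed
  next
    fix m n :: 'd assume mn: "m \<noteq> n"
    let ?A = "(\<chi> i j. of_bool (i = m \<and> j = n \<or> i = j)) :: real^'d^'d"
    have "?A = (\<chi> k. if k = m then row m (mat 1) + 1 *s row n (mat 1) else row k (mat 1))"
      using mn by (auto simp: vec_eq_iff row_def mat_def)
    then have dA: "det ?A = 1"
      using det_row_operation[OF mn, of "mat 1 :: real^'d^'d" 1] by simp
    have A: "?A *v v = v + (v \<bullet> axis n 1) *\<^sub>R axis m 1" for v
    proof (intro vec_eq_iff[THEN iffD2] allI)
      fix i
      have "(?A *v v) $ i = (\<Sum>j\<in>UNIV. (if j = i then v $ j else 0) + (if j = n then (if i = m then v $ n else 0) else 0))"
        unfolding matrix_vector_mult_def using mn by (auto intro!: sum.cong)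
      also have "\<dots> = v $ i + (if i = m then v $ n else 0)"
        unfolding sum.distrib by simp
      finally show "(?A *v v) $ i = (v + (v \<bullet> axis n 1) *\<^sub>R axis m 1) $ i"
        by (simp add: inner_axis axis_nth)
    qed
    show "?P ?A"
      using nn_integral_lborel_shear[of "axis m 1 :: real^'d" "axis n 1"] mn
      by (simp only: dA A) (simp add: Basis_vec_real axis_eq_axis)
  qed
  then show ?thesis using assms(2) by (rule bspec[OF mp[OF _ assms(1)]])
qed

section \<open>Positive homogeneous symbols\<close>

text \<open>
  This is the sum over shells that bounds the integral of \<open>exp(- c R)\<close>: volumes grow exponentially
  in the shell number, while the integrand decays doubly exponentially.
\<close>

lemma summable_exp_exp:
  fixes a c :: real
  assumes "c > 0"
  shows "summable (\<lambda>k. exp (real k * a) * exp (- c * exp (real k)))"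
proof (rule summable_comparison_test_ev)
  show "summable (\<lambda>k. exp (-1) ^ k :: real)"
    by (simp add: summable_geometric)
  have "\<forall>\<^sub>F k::nat in sequentially. (\<bar>a\<bar> + 1) * real k \<le> c * exp (real k)"
    using assms by real_asymp
  then show "\<forall>\<^sub>F k in sequentially. norm (exp (real k * a) * exp (- c * exp (real k))) \<le> exp (-1) ^ k"
  proof eventually_elim
    case (elim k)
    have "real k * a \<le> real k * \<bar>a\<bar>" by (intro mult_left_mono) auto
    then have "real k * a - c * exp (real k) \<le> - real k"
      using elim by (simp add: algebra_simps)
    then show ?case
      by (simp add: exp_of_nat_mult[symmetric] exp_add[symmetric])
  qed
qed

text \<open>
  The one-parameter group \<open>t^E\<close> is parametrised additively by \<open>s = ln t\<close>, so that homogeneity reads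
  \<open>P(e^(sE) \<xi>) = e^s P(\<xi>)\<close>.
\<close>

locale homogeneous_symbol =
  fixes P :: "real^'d \<Rightarrow> complex" and E :: "real^'d^'d"
  assumes cont: "continuous_on UNIV P"
    and nonneg: "Re (P \<xi>) \<ge> 0"
    and definite: "Re (P \<xi>) = 0 \<Longrightarrow> \<xi> = 0"
    and homogeneous: "P (mat_exp (s *\<^sub>R E) *v \<xi>) = complex_of_real (exp s) * P \<xi>"
begin

abbreviation R where "R \<xi> \<equiv> Re (P \<xi>)"

definition flow :: "real \<Rightarrow> real^'d \<Rightarrow> real^'d" where
  "flow s \<xi> = mat_exp (s *\<^sub>R E) *v \<xi>"

lemma flow_inverse: "flow s (flow (- s) \<xi>) = \<xi>"
  by (simp add: flow_def matrix_vector_mul_assoc mat_exp_inverse del: scaleR_minus_left)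

lemma flow_scaleR: "flow s (c *\<^sub>R \<xi>) = c *\<^sub>R flow s \<xi>"
  by (simp add: flow_def matrix_vector_mult_scaleR)

lemma flow_0: "flow 0 \<xi> = \<xi>"
  by (simp add: flow_def mat_exp_0)

lemma homogeneous_flow: "P (flow s \<xi>) = complex_of_real (exp s) * P \<xi>"
  by (simp add: flow_def homogeneous)

lemma R_flow: "R (flow s \<xi>) = exp s * R \<xi>"
  by (simp add: homogeneous_flow)

lemma P_0: "P 0 = 0"
proof -
  have "P 0 = complex_of_real (exp 1) * P 0"
    using homogeneous[of 1 0] by simp
  then show ?thesis
    by (simp add: complex_eq_iff)
qed

lemma R_pos: "\<xi> \<noteq> 0 \<Longrightarrow> R \<xi> > 0"
  using nonneg definite by (metis order_le_less)

lemma measurable_P [measurable]: "P \<in> borel_measurable borel"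
  by (intro borel_measurable_continuous_onI cont)

lemma measurable_flow [measurable]: "flow s \<in> borel_measurable borel"
  unfolding flow_def[abs_def] by (intro borel_measurable_continuous_onI matrix_vector_mult_linear_continuous_on)

lemma continuous_flow: "continuous_on UNIV (\<lambda>s. flow s \<xi>)"
proof -
  have "continuous_on UNIV (\<lambda>t. mat_exp (t *\<^sub>R E) $ i $ j)" for i j
    by (rule continuous_at_imp_continuous_on) (auto intro: DERIV_isCont DERIV_mat_exp_entry(1))
  then show ?thesis
    unfolding flow_def matrix_vector_mult_def
    by (intro continuous_on_vec_lambda continuous_on_sum continuous_on_mult continuous_on_const)
qed

lemma R_sphere_lower: obtains m where "m > 0" "\<And>\<xi>. norm \<xi> = 1 \<Longrightarrow> R \<xi> \<ge> m"
proof -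
  have "\<exists>x\<in>sphere 0 1. \<forall>y\<in>sphere 0 1. R x \<le> R y"
    by (rule continuous_attains_inf) (auto intro!: continuous_intros continuous_on_subset[OF cont])
  then obtain x where "norm x = 1" "\<And>y. norm y = 1 \<Longrightarrow> R x \<le> R y"
    by auto
  moreover from this have "R x > 0" by (intro R_pos) auto
  ultimately show ?thesis using that by blast
qed

text \<open>
  For a unit vector \<open>u\<close> the value \<open>R(e^(sE) u) = e^s R(u)\<close> is at least \<open>e^s\<close> times the minimum of
  \<open>R\<close> on the sphere; once this exceeds the maximum of \<open>R\<close> on the ball of radius \<open>K\<close>, the vector
  \<open>e^(sE) u\<close> must lie outside that ball.  Linearity removes the normalisation of \<open>u\<close>.
\<close>

lemma flow_expands: "\<exists>S. \<forall>s\<ge>S. \<forall>\<xi>. norm (flow s \<xi>) \<ge> K * norm \<xi>"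
proof -
  obtain m where m: "m > 0" "\<And>\<xi>. norm \<xi> = 1 \<Longrightarrow> R \<xi> \<ge> m" using R_sphere_lower by blast
  have "compact (R ` cball 0 K)"
    by (intro compact_continuous_image continuous_intros continuous_on_subset[OF cont]) auto
  then obtain B where B: "\<And>\<xi>. norm \<xi> \<le> K \<Longrightarrow> R \<xi> \<le> B"
    by (meson bounded_imp_bdd_above bdd_above.unfold compact_imp_bounded image_eqI mem_cball_0)
  have "norm (flow s \<xi>) \<ge> K * norm \<xi>" if s: "s \<ge> ln ((\<bar>B\<bar> + 1) / m)" for s \<xi>
  proof (cases "\<xi> = 0")
    case True
    then show ?thesis by simp
  next
    case False
    let ?u = "\<xi> /\<^sub>R norm \<xi>"
    have u: "norm ?u = 1" using False by simp
    have "0 < (\<bar>B\<bar> + 1) / m" using m(1) by simp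
    then have "(\<bar>B\<bar> + 1) / m = exp (ln ((\<bar>B\<bar> + 1) / m))" by simp
    also have "\<dots> \<le> exp s" using s by simp
    finally have "(\<bar>B\<bar> + 1) / m \<le> exp s" .
    then have "B < exp s * m"
      using m(1) by (simp add: field_simps)
    also have "\<dots> \<le> exp s * R ?u"
      using m(2)[OF u] by simp
    also have "\<dots> = R (flow s ?u)" by (simp only: R_flow)
    finally have "norm (flow s ?u) > K" using B by (meson not_less)
    then show ?thesis
      using False by (simp add: flow_scaleR field_simps)
  qed
  then show ?thesis by blast
qed

lemma flow_contracts: "((\<lambda>s. flow (- s) \<xi>) \<longlongrightarrow> 0) at_top"
proof (rule tendstoI)
  fix \<epsilon> :: real assume \<epsilon>: "\<epsilon> > 0"
  \<comment> \<open>Stretching by \<open>c / \<epsilon>\<close> forces \<open>|e^(-sE) \<xi>| \<le> \<epsilon> |\<xi>| / c\<close>, which is below \<open>\<epsilon>\<close> as \<open>c > |\<xi>|\<close>.\<close>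
  define c where "c = norm \<xi> + 1"
  have c: "c > 0" by (simp add: c_def add_nonneg_pos)
  obtain S where S: "\<And>s \<eta>. s \<ge> S \<Longrightarrow> norm (flow s \<eta>) \<ge> (c / \<epsilon>) * norm \<eta>"
    using flow_expands[of "c / \<epsilon>"] by blast
  have "dist (flow (- s) \<xi>) 0 < \<epsilon>" if "s \<ge> S" for s
  proof -
    have "c / \<epsilon> * norm (flow (- s) \<xi>) \<le> norm \<xi>"
      using S[OF that, of "flow (- s) \<xi>"] by (simp add: flow_inverse)
    also have "\<dots> < c" by (simp add: c_def)
    finally have "c * norm (flow (- s) \<xi>) < c * \<epsilon>"
      using \<epsilon> by (simp add: field_simps)
    then show ?thesis using c by simp
  qed
  then show "\<forall>\<^sub>F s in at_top. dist (flow (- s) \<xi>) 0 < \<epsilon>"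
    unfolding eventually_at_top_linorder by blast
qed

text \<open>
  A trajectory starting outside the unit ball crosses the unit sphere on its way to \<open>0\<close>, and \<open>R\<close>
  decreases along it.
\<close>

lemma R_lower: obtains m where "m > 0" "\<And>\<xi>. norm \<xi> \<ge> 1 \<Longrightarrow> R \<xi> \<ge> m"
proof -
  obtain m where m: "m > 0" "\<And>\<xi>. norm \<xi> = 1 \<Longrightarrow> R \<xi> \<ge> m" using R_sphere_lower by blast
  have "R \<xi> \<ge> m" if \<xi>: "norm \<xi> \<ge> 1" for \<xi>
  proof -
    have "\<forall>\<^sub>F s in at_top. dist (flow (- s) \<xi>) 0 < 1 \<and> s \<ge> 0"
      by (intro eventually_conj tendstoD[OF flow_contracts] eventually_ge_at_top) auto
    then obtain S where S: "dist (flow (- S) \<xi>) 0 < 1" "S \<ge> 0"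
      using eventually_happens'[OF trivial_limit_at_top_linorder] by blast
    have "\<exists>s\<ge>0. s \<le> S \<and> norm (flow (- s) \<xi>) = 1"
      using \<xi> S
      by (intro IVT2' continuous_intros continuous_on_compose2[OF continuous_flow]) (auto simp: flow_0)
    then obtain s where s: "s \<ge> 0" "norm (flow (- s) \<xi>) = 1" by blast
    have "m \<le> 1 * R (flow (- s) \<xi>)" using m(2)[OF s(2)] by simp
    also have "\<dots> \<le> exp s * R (flow (- s) \<xi>)" using s nonneg by (intro mult_right_mono) auto
    also have "\<dots> = R \<xi>" by (simp only: R_flow[symmetric] flow_inverse)
    finally show ?thesis .
  qed
  with m(1) show ?thesis using that by blast
qed

lemma nn_integral_flow:
  assumes [measurable]: "g \<in> borel_measurable borel"
  shows "(\<integral>\<^sup>+\<xi>. g \<xi> \<partial>lborel) = ennreal (exp (s * trace E)) * (\<integral>\<^sup>+\<xi>. g (flow s \<xi>) \<partial>lborel)"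
  using nn_integral_lborel_linear[of "mat_exp (s *\<^sub>R E)" g] by (simp add: det_mat_exp flow_def)

text \<open>
  The ellipsoids \<open>B k = e^(kE) (unit ball)\<close> cover the space because the backward flow contracts, and
  \<open>B k\<close> has volume proportional to \<open>e^(k tr E)\<close>.  Outside \<open>B k\<close> homogeneity and the lower bound
  for \<open>R\<close> off the unit ball give \<open>R \<ge> m e^k\<close>.
\<close>

lemma integrable_exp_R:
  assumes c: "c > 0"
  shows "integrable lborel (\<lambda>\<xi>. exp (- c * R \<xi>))"
proof (rule integrableI_nonneg)
  obtain m where m: "m > 0" "\<And>\<xi>. norm \<xi> \<ge> 1 \<Longrightarrow> R \<xi> \<ge> m" using R_lower by blast
  define B where "B k = {\<xi>. norm (flow (- real k) \<xi>) \<le> 1}" for k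
  define V where "V = emeasure lborel (cball (0::real^'d) 1)"
  have V: "V < \<infinity>" unfolding V_def by (rule emeasure_lborel_cball_finite)
  have Bm [measurable]: "B k \<in> sets borel" for k
    unfolding B_def by measurable
  have eB: "emeasure lborel (B k) = ennreal (exp (real k * trace E)) * V" for k
  proof -
    have "emeasure lborel (B k) = (\<integral>\<^sup>+\<xi>. indicator (B k) \<xi> \<partial>lborel)"
      by simp
    also have "\<dots> = ennreal (exp (real k * trace E)) * (\<integral>\<^sup>+\<xi>. indicator (B k) (flow (real k) \<xi>) \<partial>lborel)"
      by (rule nn_integral_flow) measurable
    also have "(\<integral>\<^sup>+\<xi>. indicator (B k) (flow (real k) \<xi>) \<partial>lborel) = (\<integral>\<^sup>+\<xi>. indicator (cball (0::real^'d) 1) \<xi> \<partial>lborel)"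
      using flow_inverse[of "- real k"] by (intro nn_integral_cong) (auto simp: B_def indicator_def)
    finally show ?thesis by (simp add: V_def)
  qed
  let ?w = "\<lambda>k. exp (- c * m * exp (real k))"
  have bound: "ennreal (exp (- c * R \<xi>)) \<le> indicator (B 0) \<xi> + (\<Sum>k. ennreal (?w k) * indicator (B (Suc k)) \<xi>)" for \<xi>
  proof -
    have "\<forall>\<^sub>F s in at_top. dist (flow (- s) \<xi>) 0 < 1"
      by (intro tendstoD[OF flow_contracts]) auto
    then have "\<forall>\<^sub>F k in sequentially. dist (flow (- real k) \<xi>) 0 < 1"
      using filterlim_real_sequentially by (rule eventually_compose_filterlim)
    then have "\<exists>k. \<xi> \<in> B k"
      unfolding B_def eventually_sequentially by (auto intro: less_imp_le)
    \<comment> \<open>For \<open>k = j + 1\<close>, minimality puts \<open>\<xi>\<close> outside \<open>B j\<close>, where \<open>R\<close> is at least \<open>m e^j\<close>.\<close>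
    define k where "k = (LEAST k. \<xi> \<in> B k)"
    have k: "\<xi> \<in> B k" "\<And>j. j < k \<Longrightarrow> \<xi> \<notin> B j"
      unfolding k_def by (rule LeastI_ex[OF \<open>\<exists>k. \<xi> \<in> B k\<close>], rule not_less_Least)
    show ?thesis
    proof (cases k)
      case 0
      have "ennreal (exp (- c * R \<xi>)) \<le> 1" using c nonneg by simp
      then show ?thesis using 0 k by (simp add: add_increasing2)
    next
      case (Suc j)
      then have "norm (flow (- real j) \<xi>) \<ge> 1" using k(2)[of j] by (simp add: B_def)
      then have "m \<le> R (flow (- real j) \<xi>)" by (rule m(2))
      then have "exp (real j) * m \<le> exp (real j) * R (flow (- real j) \<xi>)" by simp
      also have "\<dots> = R \<xi>" by (simp only: R_flow[symmetric] flow_inverse)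
      finally have "exp (- c * R \<xi>) \<le> ?w j" using c by (simp add: mult_ac)
      then have "ennreal (exp (- c * R \<xi>)) \<le> ennreal (?w j) * indicator (B (Suc j)) \<xi>"
        using k Suc by (simp add: ennreal_leI)
      also have "\<dots> \<le> (\<Sum>k. ennreal (?w k) * indicator (B (Suc k)) \<xi>)"
      proof -
        have "(\<Sum>k\<in>{j}. ennreal (?w k) * indicator (B (Suc k)) \<xi>)
            \<le> (\<Sum>k. ennreal (?w k) * indicator (B (Suc k)) \<xi>)"
          by (rule sum_le_suminf) auto
        then show ?thesis by (simp only: sum.insert finite.emptyI empty_iff sum.empty add_0_right not_False_eq_True)
      qed
      finally show ?thesis by (simp add: add_increasing)
    qed
  qed
  have sm: "summable (\<lambda>k. exp (real (Suc k) * trace E) * ?w k)"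
  proof -
    have "summable (\<lambda>k. exp (trace E) * (exp (real k * trace E) * exp (- (c * m) * exp (real k))))"
      using c m by (intro summable_mult summable_exp_exp) simp
    moreover have "exp (trace E) * (exp (real k * trace E) * exp (- (c * m) * exp (real k)))
        = exp (real (Suc k) * trace E) * ?w k" for k
      unfolding exp_add[symmetric] by (simp add: algebra_simps)
    ultimately show ?thesis by (simp only:)
  qed
  have "(\<integral>\<^sup>+\<xi>. ennreal (exp (- c * R \<xi>)) \<partial>lborel)
      \<le> (\<integral>\<^sup>+\<xi>. indicator (B 0) \<xi> + (\<Sum>k. ennreal (?w k) * indicator (B (Suc k)) \<xi>) \<partial>lborel)"
    by (intro nn_integral_mono bound)
  also have "\<dots> = emeasure lborel (B 0) + (\<Sum>k. ennreal (?w k) * emeasure lborel (B (Suc k)))"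
    by (simp add: nn_integral_add nn_integral_suminf nn_integral_cmult)
  also have "\<dots> = V + (\<Sum>k. ennreal (exp (real (Suc k) * trace E) * ?w k) * V)"
    by (simp add: eB ennreal_mult' mult_ac)
  also have "\<dots> = V + ennreal (\<Sum>k. exp (real (Suc k) * trace E) * ?w k) * V"
    by (subst suminf_ennreal2[OF _ sm, symmetric]) (simp, rule arg_cong[where f = "(+) V"], rule ennreal_suminf_multc)
  also have "\<dots> < \<infinity>"
    using V by (simp add: ennreal_mult_less_top)
  finally show "(\<integral>\<^sup>+\<xi>. ennreal (exp (- c * R \<xi>)) \<partial>lborel) < \<infinity>" .
qed auto

end

context homogeneous_symbol
begin

lemma integral_flow:
  fixes g :: "real^'d \<Rightarrow> real"
  assumes [measurable]: "g \<in> borel_measurable borel" and g: "\<And>\<xi>. g \<xi> \<ge> 0"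
  shows "exp (s * trace E) * (LINT \<xi>|lborel. g \<xi>) = (LINT \<xi>|lborel. g (flow (- s) \<xi>))"
proof -
  have "(LINT \<xi>|lborel. g \<xi>) = enn2real (\<integral>\<^sup>+\<xi>. ennreal (g \<xi>) \<partial>lborel)"
    using g by (intro integral_eq_nn_integral) auto
  also have "(\<integral>\<^sup>+\<xi>. ennreal (g \<xi>) \<partial>lborel)
      = ennreal (exp (- s * trace E)) * (\<integral>\<^sup>+\<xi>. ennreal (g (flow (- s) \<xi>)) \<partial>lborel)"
    by (rule nn_integral_flow) measurable
  also have "enn2real \<dots> = exp (- s * trace E) * (LINT \<xi>|lborel. g (flow (- s) \<xi>))"
    using g by (subst integral_eq_nn_integral) (auto simp: enn2real_mult)
  finally show ?thesis
    by (simp add: exp_minus)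
qed

lemma integral_exp_R_scaled:
  assumes n: "n > 0"
  shows "n powr trace E * (LINT \<xi>|lborel. exp (- n * R \<xi>)) = (LINT \<xi>|lborel. exp (- R \<xi>))"
proof -
  have "R (flow (- ln n) \<xi>) = R \<xi> / n" for \<xi>
    using n by (simp add: R_flow exp_minus field_simps)
  then show ?thesis
    using integral_flow[of "\<lambda>\<xi>. exp (- n * R \<xi>)" "ln n"] n by (simp add: powr_def mult.commute)
qed

lemma heat_kernel_eq:
  "(2 * complex_of_real pi) ^ CARD('d) * heat_kernel P t x
    = (LINT \<xi>|lborel. exp (- complex_of_real t * P \<xi>) * exp (- \<i> * complex_of_real (x \<bullet> \<xi>)))"
  by (simp add: heat_kernel_def)

text \<open>
  Taking moduli inside the integral removes \<open>x\<close>; scaling then produces the factor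
  \<open>n^(- tr E)\<close>.
\<close>

lemma heat_kernel_bound:
  assumes n: "n > 0"
  shows "norm ((2 * complex_of_real pi) ^ CARD('d) * heat_kernel P n x)
     \<le> (LINT \<xi>|lborel. exp (- R \<xi>)) * n powr (- trace E)"
proof -
  have "norm (LINT \<xi>|lborel. exp (- complex_of_real n * P \<xi>) * exp (- \<i> * complex_of_real (x \<bullet> \<xi>)))
     \<le> (LINT \<xi>|lborel. norm (exp (- complex_of_real n * P \<xi>) * exp (- \<i> * complex_of_real (x \<bullet> \<xi>))))"
    by (rule integral_norm_bound)
  also have "\<dots> = (LINT \<xi>|lborel. exp (- n * R \<xi>))"
    by (simp add: norm_mult)
  also have "\<dots> = n powr (- trace E) * (n powr trace E * (LINT \<xi>|lborel. exp (- n * R \<xi>)))"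
    using n by (simp add: mult.assoc[symmetric] powr_add[symmetric])
  also have "\<dots> = (LINT \<xi>|lborel. exp (- R \<xi>)) * n powr (- trace E)"
    by (simp only: integral_exp_R_scaled[OF n] mult.commute)
  finally show ?thesis
    by (simp only: heat_kernel_eq)
qed

end

section \<open>The local limit near a point of maximal modulus\<close>

text \<open>
  Here \<open>h(\<xi>)\<close> stands for the quotient \<open>f(\<eta> + \<xi>) / f(\<eta>)\<close> near a point \<open>\<eta>\<close> where the transform
  \<open>f\<close> has modulus one, and \<open>U\<close> is so small that the remainder is dominated by half of \<open>R\<close>.
\<close>

locale local_expansion = homogeneous_symbol P E for P :: "real^'d \<Rightarrow> complex" and E +
  fixes U :: "(real^'d) set" and h \<Upsilon> :: "real^'d \<Rightarrow> complex" and \<alpha> :: "real^'d"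
  assumes open_U: "open U" and zero_in_U: "0 \<in> U"
    and measurable_h [measurable]: "h \<in> borel_measurable borel"
    and expansion: "\<xi> \<in> U \<Longrightarrow> h \<xi> = exp (\<i> * complex_of_real (\<alpha> \<bullet> \<xi>) - P \<xi> + \<Upsilon> \<xi>)"
    and remainder_half: "\<xi> \<in> U \<Longrightarrow> norm (\<Upsilon> \<xi>) \<le> R \<xi> / 2"
    and remainder_small: "\<Upsilon> \<in> o[at 0](\<lambda>\<xi>. complex_of_real (R \<xi>))"
begin

text \<open>
  The modulus of the difference between the integrand restricted to \<open>U\<close> and the full heat kernel
  integrand.  The oscillating factor containing \<open>x\<close> has modulus one and drops out; off \<open>U\<close> only the
  heat kernel integrand is present.
\<close>

definition discrepancy :: "nat \<Rightarrow> real^'d \<Rightarrow> real" where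
  "discrepancy n \<xi> = (if \<xi> \<in> U then norm (h \<xi> ^ n - exp (of_nat n * (\<i> * complex_of_real (\<alpha> \<bullet> \<xi>) - P \<xi>)))
     else exp (- real n * R \<xi>))"

lemma measurable_U [measurable]: "U \<in> sets borel"
  using open_U by simp

lemma measurable_discrepancy [measurable]: "discrepancy n \<in> borel_measurable borel"
  unfolding discrepancy_def[abs_def] by measurable

lemma discrepancy_nonneg: "discrepancy n \<xi> \<ge> 0"
  by (simp add: discrepancy_def)

lemma h_power:
  assumes "\<xi> \<in> U"
  shows "h \<xi> ^ n = exp (of_nat n * (\<i> * complex_of_real (\<alpha> \<bullet> \<xi>) - P \<xi>)) * exp (of_nat n * \<Upsilon> \<xi>)"
  using assms by (simp add: expansion exp_of_nat_mult[symmetric] exp_add[symmetric] algebra_simps)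

lemma norm_h_power:
  assumes "\<xi> \<in> U"
  shows "norm (h \<xi> ^ n) \<le> exp (- (real n * R \<xi> / 2))"
proof -
  have "Re (\<Upsilon> \<xi>) \<le> R \<xi> / 2"
    using remainder_half[OF assms] complex_Re_le_cmod order_trans by blast
  then have "real n * Re (\<Upsilon> \<xi>) \<le> real n * (R \<xi> / 2)" by (intro mult_left_mono) auto
  then show ?thesis
    using assms by (simp add: h_power norm_mult exp_add[symmetric] algebra_simps)
qed

lemma discrepancy_bound: "discrepancy n \<xi> \<le> 2 * exp (- (real n * R \<xi> / 2))"
proof -
  have le: "exp (- real n * R \<xi>) \<le> exp (- (real n * R \<xi> / 2))"
    using nonneg[of \<xi>] by (simp add: field_simps)
  show ?thesis
  proof (cases "\<xi> \<in> U")
    case True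
    have "discrepancy n \<xi> \<le> norm (h \<xi> ^ n) + norm (exp (of_nat n * (\<i> * complex_of_real (\<alpha> \<bullet> \<xi>) - P \<xi>)))"
      using True by (simp only: discrepancy_def if_True norm_triangle_ineq4)
    also have "\<dots> \<le> exp (- (real n * R \<xi> / 2)) + exp (- real n * R \<xi>)"
      by (intro add_mono norm_h_power True) simp
    finally show ?thesis using le by linarith
  next
    case False
    have "0 \<le> exp (- (real n * R \<xi> / 2))" by simp
    moreover have "discrepancy n \<xi> = exp (- real n * R \<xi>)"
      using False by (simp add: discrepancy_def)
    ultimately show ?thesis using le by linarith
  qed
qed

text \<open>
  The condition \<open>\<Upsilon> = o(R)\<close> is exactly what survives the scaling, since \<open>n R(n^(-E) \<eta>) = R(\<eta>)\<close> does
  not depend on \<open>n\<close>.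
\<close>

lemma remainder_rescaled:
  "(\<lambda>n. of_nat (Suc n) * \<Upsilon> (flow (- ln (real (Suc n))) \<eta>)) \<longlonglongrightarrow> 0"
proof (rule tendstoI)
  fix \<delta> :: real assume \<delta>: "\<delta> > 0"
  let ?z = "\<lambda>n. flow (- ln (real (Suc n))) \<eta>"
  \<comment> \<open>The summand 1 keeps the constant defined at \<open>\<eta> = 0\<close>, where \<open>R\<close> vanishes.\<close>
  define c where "c = \<delta> / (R \<eta> + 1)"
  have c: "c > 0" "c * R \<eta> < \<delta>" using \<delta> nonneg[of \<eta>] by (auto simp: c_def field_simps add_pos_nonneg)
  have "\<forall>\<^sub>F \<xi> in at 0. norm (\<Upsilon> \<xi>) \<le> c * norm (complex_of_real (R \<xi>))"
    using landau_o.smallD[OF remainder_small c(1)] .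
  then have "\<forall>\<^sub>F \<xi> in nhds 0. norm (\<Upsilon> \<xi>) \<le> c * R \<xi>"
    using remainder_half[OF zero_in_U] nonneg by (auto simp: eventually_at_filter P_0 elim!: eventually_mono)
  moreover have "filterlim (\<lambda>n. ln (real (Suc n))) at_top sequentially"
    by (rule filterlim_compose[OF ln_at_top filterlim_compose[OF filterlim_real_sequentially filterlim_Suc]])
  then have "?z \<longlonglongrightarrow> 0"
    by (rule filterlim_compose[OF flow_contracts])
  ultimately have "\<forall>\<^sub>F n in sequentially. norm (\<Upsilon> (?z n)) \<le> c * R (?z n)"
    by (rule eventually_compose_filterlim)
  then show "\<forall>\<^sub>F n in sequentially. dist (of_nat (Suc n) * \<Upsilon> (?z n)) 0 < \<delta>"
  proof eventually_elim
    case (elim n)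
    have "norm (of_nat (Suc n) * \<Upsilon> (?z n)) = real (Suc n) * norm (\<Upsilon> (?z n))"
      by (simp only: norm_mult norm_of_nat)
    also have "\<dots> \<le> real (Suc n) * (c * R (?z n))"
      by (intro mult_left_mono elim) auto
    also have "\<dots> = c * R \<eta>"
      by (simp add: R_flow exp_minus field_simps del: of_nat_Suc)
    finally show ?case using c(2) by simp
  qed
qed

text \<open>
  After the substitution \<open>\<xi> = n^(-E) \<eta>\<close> the majorant \<open>2 exp(- R / 2)\<close> is independent of \<open>n\<close>.
  Pointwise, \<open>n^(-E) \<eta>\<close> eventually lies in \<open>U\<close>, where the discrepancy is
  \<open>exp(- R(\<eta>))\<close> times \<open>|exp(n \<Upsilon>(n^(-E) \<eta>)) - 1|\<close>.
\<close>

lemma discrepancy_integral_tendsto_0: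
  "(\<lambda>n. real n powr trace E * (LINT \<xi>|lborel. discrepancy n \<xi>)) \<longlonglongrightarrow> 0"
proof (rule LIMSEQ_imp_Suc)
  let ?z = "\<lambda>n. flow (- ln (real (Suc n)))"
  have "real (Suc n) powr trace E * (LINT \<xi>|lborel. discrepancy (Suc n) \<xi>)
      = (LINT \<eta>|lborel. discrepancy (Suc n) (?z n \<eta>))" for n
    using integral_flow[of "discrepancy (Suc n)" "ln (real (Suc n))"]
    by (simp add: discrepancy_nonneg powr_def mult.commute)
  moreover have "(\<lambda>n. LINT \<eta>|lborel. discrepancy (Suc n) (?z n \<eta>)) \<longlonglongrightarrow> (LINT \<eta>::real^'d|lborel. (0::real))"
  proof (rule integral_dominated_convergence[where w = "\<lambda>\<eta>. 2 * exp (- (1/2) * R \<eta>)"])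
    show "integrable lborel (\<lambda>\<eta>. 2 * exp (- (1/2) * R \<eta>))"
      by (intro integrable_mult_right integrable_exp_R) simp
    show "AE \<eta> in lborel. norm (discrepancy (Suc n) (?z n \<eta>)) \<le> 2 * exp (- (1/2) * R \<eta>)" for n
    proof (rule AE_I2)
      fix \<eta>
      have "real (Suc n) * R (?z n \<eta>) = R \<eta>"
        by (simp add: R_flow exp_minus field_simps del: of_nat_Suc)
      then show "norm (discrepancy (Suc n) (?z n \<eta>)) \<le> 2 * exp (- (1/2) * R \<eta>)"
        using discrepancy_bound[of "Suc n" "?z n \<eta>"] by (simp add: discrepancy_nonneg)
    qed
    show "AE \<eta> in lborel. (\<lambda>n. discrepancy (Suc n) (?z n \<eta>)) \<longlonglongrightarrow> 0"
    proof (rule AE_I2)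
      fix \<eta>
      have "filterlim (\<lambda>n. ln (real (Suc n))) at_top sequentially"
        by (rule filterlim_compose[OF ln_at_top filterlim_compose[OF filterlim_real_sequentially filterlim_Suc]])
      then have "(\<lambda>n. ?z n \<eta>) \<longlonglongrightarrow> 0"
        by (rule filterlim_compose[OF flow_contracts])
      then have near: "\<forall>\<^sub>F n in sequentially. ?z n \<eta> \<in> U"
        using open_U zero_in_U by (rule topological_tendstoD)
      have eq: "discrepancy (Suc n) (?z n \<eta>)
          = exp (- R \<eta>) * norm (exp (of_nat (Suc n) * \<Upsilon> (?z n \<eta>)) - 1)" if "?z n \<eta> \<in> U" for n
      proof -
        have R: "real (Suc n) * R (?z n \<eta>) = R \<eta>"
          by (simp add: R_flow exp_minus field_simps del: of_nat_Suc)
        let ?e = "exp (of_nat (Suc n) * (\<i> * complex_of_real (\<alpha> \<bullet> ?z n \<eta>) - P (?z n \<eta>)))"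
        have "discrepancy (Suc n) (?z n \<eta>) = norm (?e * (exp (of_nat (Suc n) * \<Upsilon> (?z n \<eta>)) - 1))"
          using that by (simp add: discrepancy_def h_power right_diff_distrib del: of_nat_Suc power_Suc)
        also have "\<dots> = exp (- (real (Suc n) * R (?z n \<eta>))) * norm (exp (of_nat (Suc n) * \<Upsilon> (?z n \<eta>)) - 1)"
          by (simp add: norm_mult del: of_nat_Suc)
        finally show ?thesis by (simp only: R)
      qed
      have ev: "\<forall>\<^sub>F n in sequentially. exp (- R \<eta>) * norm (exp (of_nat (Suc n) * \<Upsilon> (?z n \<eta>)) - 1)
          = discrepancy (Suc n) (?z n \<eta>)"
        using near by (rule eventually_mono) (rule eq[symmetric])
      have "(\<lambda>n. exp (- R \<eta>) * norm (exp (of_nat (Suc n) * \<Upsilon> (?z n \<eta>)) - 1))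
          \<longlonglongrightarrow> exp (- R \<eta>) * norm (exp 0 - 1 :: complex)"
        by (intro tendsto_intros remainder_rescaled)
      then show "(\<lambda>n. discrepancy (Suc n) (?z n \<eta>)) \<longlonglongrightarrow> 0"
        using Lim_transform_eventually[OF _ ev] by simp
    qed
  qed (auto simp del: of_nat_Suc)
  ultimately show "(\<lambda>n. real (Suc n) powr trace E * (LINT \<xi>|lborel. discrepancy (Suc n) \<xi>)) \<longlonglongrightarrow> 0"
    by simp
qed

text \<open>
  The drift enters through \<open>exp(i n \<alpha> \<cdot> \<xi>)\<close>, which is absorbed by moving the argument of the heat
  kernel to \<open>x - n \<alpha>\<close>.
\<close>

lemma local_error:
  assumes n: "n > 0"
  shows "norm ((LINT \<xi>|lborel. indicator U \<xi> *\<^sub>R (h \<xi> ^ n * exp (- \<i> * complex_of_real (x \<bullet> \<xi>))))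
      - (2 * complex_of_real pi) ^ CARD('d) * heat_kernel P (real n) (x - real n *\<^sub>R \<alpha>))
     \<le> (LINT \<xi>|lborel. discrepancy n \<xi>)"
proof -
  let ?e = "\<lambda>\<xi>. exp (- \<i> * complex_of_real (x \<bullet> \<xi>))"
  let ?f = "\<lambda>\<xi>. indicator U \<xi> *\<^sub>R (h \<xi> ^ n * ?e \<xi>)"
  let ?g = "\<lambda>\<xi>. exp (of_nat n * (\<i> * complex_of_real (\<alpha> \<bullet> \<xi>) - P \<xi>)) * ?e \<xi>"
  have g: "(2 * complex_of_real pi) ^ CARD('d) * heat_kernel P (real n) (x - real n *\<^sub>R \<alpha>)
      = (LINT \<xi>|lborel. ?g \<xi>)"
    unfolding heat_kernel_eq exp_add[symmetric]
    by (intro Bochner_Integration.integral_cong refl arg_cong[where f = exp])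
       (simp add: inner_diff_left algebra_simps)
  have ig: "integrable lborel ?g"
  proof (rule Bochner_Integration.integrable_bound)
    show "integrable lborel (\<lambda>\<xi>. exp (- real n * R \<xi>))"
      using n by (intro integrable_exp_R) simp
  qed (auto simp: norm_mult)
  have "integrable lborel ?f"
  proof (rule Bochner_Integration.integrable_bound)
    show "integrable lborel (\<lambda>\<xi>. exp (- (real n / 2) * R \<xi>))"
      using n by (intro integrable_exp_R) simp
    show "AE \<xi> in lborel. norm (?f \<xi>) \<le> norm (exp (- (real n / 2) * R \<xi>))"
      using norm_h_power by (intro AE_I2) (auto simp: norm_mult indicator_def)
  qed auto
  then have "norm ((LINT \<xi>|lborel. ?f \<xi>) - (LINT \<xi>|lborel. ?g \<xi>)) = norm (LINT \<xi>|lborel. ?f \<xi> - ?g \<xi>)"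
    using ig by simp
  also have "\<dots> \<le> (LINT \<xi>|lborel. norm (?f \<xi> - ?g \<xi>))"
    by (rule integral_norm_bound)
  also have "\<dots> = (LINT \<xi>|lborel. discrepancy n \<xi>)"
  proof (intro Bochner_Integration.integral_cong refl)
    fix \<xi>
    have "norm (h \<xi> ^ n * ?e \<xi> - ?g \<xi>) = norm (h \<xi> ^ n - exp (of_nat n * (\<i> * complex_of_real (\<alpha> \<bullet> \<xi>) - P \<xi>)))"
      unfolding left_diff_distrib[symmetric] by (simp add: norm_mult)
    then show "norm (?f \<xi> - ?g \<xi>) = discrepancy n \<xi>"
      by (auto simp: discrepancy_def norm_mult)
  qed
  finally show ?thesis by (simp only: g)
qed

end

section \<open>Fourier transforms and Fourier inversion on the lattice\<close>

abbreviation character :: "int^'d \<Rightarrow> real^'d \<Rightarrow> complex" where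
  "character x \<xi> \<equiv> exp (\<i> * complex_of_real (real_vec x \<bullet> \<xi>))"

lemma continuous_character: "continuous_on S (character x)"
  by (intro continuous_intros)

lemma Schwartz_abs_summable: "\<phi> \<in> Schwartz \<Longrightarrow> (\<lambda>x. norm (\<phi> x)) summable_on UNIV"
  unfolding Schwartz_def by (auto dest: spec[of _ "\<lambda>_. 0"])

text \<open>
  Uniform convergence gives continuity of the transform and permits integration term by term.
\<close>

lemma fourier_uniform_limit:
  assumes "(\<lambda>x. norm (\<phi> x)) summable_on UNIV"
  shows "uniform_limit UNIV (\<lambda>F \<xi>. \<Sum>x\<in>F. \<phi> x * character x \<xi>) (fourier \<phi>) (finite_subsets_at_top UNIV)"
  unfolding fourier_def[abs_def]
  by (rule Weierstrass_m_test_general[OF _ assms]) (simp add: norm_mult)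

lemma continuous_fourier:
  assumes "(\<lambda>x. norm (\<phi> x)) summable_on UNIV"
  shows "continuous_on UNIV (fourier \<phi>)"
  by (rule uniform_limit_theorem[OF _ fourier_uniform_limit[OF assms]])
     (auto intro!: always_eventually continuous_intros)

lemma norm_fourier_le:
  assumes "(\<lambda>x. norm (\<phi> x)) summable_on UNIV"
  shows "norm (fourier \<phi> \<xi>) \<le> (\<Sum>\<^sub>\<infinity>x. norm (\<phi> x))"
  unfolding fourier_def
  by (rule order_trans[OF norm_infsum_bound]) (use assms in \<open>auto simp: norm_mult\<close>)

lemma exp_2pi_int: "exp (\<i> * complex_of_real (2 * pi * real_of_int m)) = 1"
  by (simp add: exp_eq_1)

lemma fourier_periodic: "fourier \<phi> (\<xi> + (2 * pi) *\<^sub>R real_vec k) = fourier \<phi> \<xi>"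
proof -
  have "character x (\<xi> + (2 * pi) *\<^sub>R real_vec k) = character x \<xi>" for x
  proof -
    let ?m = "\<Sum>i\<in>UNIV. x $ i * k $ i"
    have "real_vec x \<bullet> real_vec k = of_int ?m"
      by (simp add: real_vec_def inner_vec_def)
    then have "\<i> * complex_of_real (real_vec x \<bullet> (\<xi> + (2 * pi) *\<^sub>R real_vec k))
        = \<i> * complex_of_real (real_vec x \<bullet> \<xi>) + \<i> * complex_of_real (2 * pi * real_of_int ?m)"
      by (simp add: inner_add_right distrib_left)
    then show ?thesis
      by (simp only: exp_add exp_2pi_int mult.right_neutral)
  qed
  then show ?thesis by (simp add: fourier_def)
qed

text \<open>
  The partial sums converge uniformly to the transform, so against an integrable \<open>g\<close> the integrals
  converge.
\<close>

lemma integral_mult_fourier: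
  assumes \<phi>: "(\<lambda>x. norm (\<phi> x)) summable_on UNIV" and g: "integrable lborel g"
  shows "((\<lambda>y. \<phi> y * (LINT \<xi>|lborel. g \<xi> * character y \<xi>)) has_sum (LINT \<xi>|lborel. g \<xi> * fourier \<phi> \<xi>)) UNIV"
  unfolding has_sum_def
proof (rule tendstoI)
  fix \<epsilon> :: real assume \<epsilon>: "\<epsilon> > 0"
  let ?S = "\<lambda>F \<xi>. \<Sum>y\<in>F. \<phi> y * character y \<xi>"
  define I where "I = (LINT \<xi>|lborel. norm (g \<xi>))"
  have I: "I \<ge> 0" by (simp add: I_def)
  have [measurable]: "g \<in> borel_measurable borel" using g by auto
  have [measurable]: "fourier \<phi> \<in> borel_measurable borel"
    by (intro borel_measurable_continuous_onI continuous_fourier \<phi>)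
  have [measurable]: "character y \<in> borel_measurable borel" for y :: "int^'a"
    by (intro borel_measurable_continuous_onI continuous_character)
  have ig: "integrable lborel (\<lambda>\<xi>. g \<xi> * character y \<xi>)" for y
    by (rule Bochner_Integration.integrable_bound[OF g]) (auto simp: norm_mult)
  have igf: "integrable lborel (\<lambda>\<xi>. g \<xi> * fourier \<phi> \<xi>)"
  proof (rule Bochner_Integration.integrable_bound)
    show "integrable lborel (\<lambda>\<xi>. (\<Sum>\<^sub>\<infinity>x. norm (\<phi> x)) * norm (g \<xi>))"
      using g by (intro integrable_mult_right integrable_norm)
    have "norm (g \<xi> * fourier \<phi> \<xi>) \<le> (\<Sum>\<^sub>\<infinity>x. norm (\<phi> x)) * norm (g \<xi>)" for \<xi>
      using mult_left_mono[OF norm_fourier_le[OF \<phi>, of \<xi>], of "norm (g \<xi>)"] by (simp add: norm_mult mult.commute)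
    then show "AE \<xi> in lborel. norm (g \<xi> * fourier \<phi> \<xi>) \<le> norm ((\<Sum>\<^sub>\<infinity>x. norm (\<phi> x)) * norm (g \<xi>))"
      by (intro AE_I2) (metis abs_ge_self order_trans real_norm_def)
  qed measurable
  have "\<epsilon> / (I + 1) > 0" using \<epsilon> I by simp
  then have "\<forall>\<^sub>F F in finite_subsets_at_top UNIV. \<forall>\<xi>\<in>UNIV. dist (?S F \<xi>) (fourier \<phi> \<xi>) < \<epsilon> / (I + 1)"
    by (rule uniform_limitD[OF fourier_uniform_limit[OF \<phi>]])
  then show "\<forall>\<^sub>F F in finite_subsets_at_top UNIV.
      dist (\<Sum>y\<in>F. \<phi> y * (LINT \<xi>|lborel. g \<xi> * character y \<xi>)) (LINT \<xi>|lborel. g \<xi> * fourier \<phi> \<xi>) < \<epsilon>"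
  proof eventually_elim
    case (elim F)
    have "(\<Sum>y\<in>F. \<phi> y * (LINT \<xi>|lborel. g \<xi> * character y \<xi>)) = (LINT \<xi>|lborel. (\<Sum>y\<in>F. \<phi> y * (g \<xi> * character y \<xi>)))"
      by (subst Bochner_Integration.integral_sum) (auto intro!: integrable_mult_right ig)
    also have "(\<lambda>\<xi>. \<Sum>y\<in>F. \<phi> y * (g \<xi> * character y \<xi>)) = (\<lambda>\<xi>. g \<xi> * ?S F \<xi>)"
      by (simp add: sum_distrib_left mult_ac)
    finally have eq: "(\<Sum>y\<in>F. \<phi> y * (LINT \<xi>|lborel. g \<xi> * character y \<xi>)) = (LINT \<xi>|lborel. g \<xi> * ?S F \<xi>)" .
    have iS: "integrable lborel (\<lambda>\<xi>. g \<xi> * ?S F \<xi>)"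
    proof -
      have "integrable lborel (\<lambda>\<xi>. \<Sum>y\<in>F. \<phi> y * (g \<xi> * character y \<xi>))"
        by (intro Bochner_Integration.integrable_sum integrable_mult_right ig)
      then show ?thesis by (simp add: sum_distrib_left mult_ac)
    qed
    have "dist (LINT \<xi>|lborel. g \<xi> * ?S F \<xi>) (LINT \<xi>|lborel. g \<xi> * fourier \<phi> \<xi>)
        = norm (LINT \<xi>|lborel. g \<xi> * ?S F \<xi> - g \<xi> * fourier \<phi> \<xi>)"
      unfolding dist_norm using iS igf by (subst Bochner_Integration.integral_diff) auto
    also have "\<dots> \<le> (LINT \<xi>|lborel. \<epsilon> / (I + 1) * norm (g \<xi>))"
    proof (rule Bochner_Integration.integral_norm_bound_integral)
      fix \<xi>
      have "norm (?S F \<xi> - fourier \<phi> \<xi>) \<le> \<epsilon> / (I + 1)"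
        using elim by (simp add: dist_norm less_imp_le)
      then show "norm (g \<xi> * ?S F \<xi> - g \<xi> * fourier \<phi> \<xi>) \<le> \<epsilon> / (I + 1) * norm (g \<xi>)"
        unfolding right_diff_distrib[symmetric] norm_mult
        by (subst mult.commute) (intro mult_right_mono norm_ge_zero)
    qed (intro Bochner_Integration.integrable_diff iS igf integrable_mult_right integrable_norm g)+
    also have "\<dots> = \<epsilon> / (I + 1) * I"
      by (simp add: I_def)
    also have "\<dots> < \<epsilon>"
      using \<epsilon> I by (simp add: field_simps)
    finally show ?case by (simp only: eq)
  qed
qed

lemma integral_exp_period:
  "(LINT y|lborel. indicator {a..a + 2 * pi} y *\<^sub>R exp (\<i> * complex_of_real (real_of_int m * y)))
    = (if m = 0 then 2 * complex_of_real pi else 0)"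
proof (cases "m = 0")
  case True
  then show ?thesis by (simp add: scaleR_conv_of_real)
next
  case False
  let ?F = "\<lambda>y. exp (\<i> * complex_of_real (real_of_int m * y)) / (\<i> * of_int m)"
  have "has_bochner_integral lborel (\<lambda>y. indicator {a..a + 2 * pi} y *\<^sub>R exp (\<i> * complex_of_real (real_of_int m * y)))
     (?F (a + 2 * pi) - ?F a)"
  proof (rule has_bochner_integral_FTC_Icc)
    fix y
    have "((\<lambda>z. exp (\<i> * of_int m * z) / (\<i> * of_int m)) has_field_derivative exp (\<i> * of_int m * complex_of_real y)) (at (complex_of_real y))"
      using False by (auto intro!: derivative_eq_intros)
    from has_vector_derivative_real_field[OF this]
    show "(?F has_vector_derivative exp (\<i> * complex_of_real (real_of_int m * y))) (at y within {a..a + 2 * pi})"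
      by (simp add: mult.assoc has_vector_derivative_at_within)
  qed (auto intro!: continuous_intros)
  moreover have "?F (a + 2 * pi) = ?F a"
  proof -
    have "\<i> * complex_of_real (real_of_int m * (a + 2 * pi))
        = \<i> * complex_of_real (real_of_int m * a) + \<i> * complex_of_real (2 * pi * real_of_int m)"
      by (simp add: algebra_simps)
    then show ?thesis by (simp only: exp_add exp_2pi_int mult.right_neutral)
  qed
  ultimately show ?thesis
    using False by (simp add: has_bochner_integral_integral_eq)
qed

text \<open>
  The closed cube is used so that compactness is available; by periodicity its lower corner may be
  placed anywhere on the diagonal.
\<close>

definition period_cube :: "real \<Rightarrow> (real^'d) set" where
  "period_cube a = cbox (\<chi> i. a) (\<chi> i. a + 2 * pi)"

lemma mem_period_cube: "\<xi> \<in> period_cube a \<longleftrightarrow> (\<forall>i. a \<le> \<xi> $ i \<and> \<xi> $ i \<le> a + 2 * pi)"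
  by (simp add: period_cube_def mem_box_cart)

text \<open>
  The character and the indicator of the cube factor over the coordinates, which reduces
  orthogonality to one dimension.
\<close>

lemma integral_character_cube:
  fixes k :: "int^'d"
  shows "(LINT \<xi>|lborel. indicator (period_cube a) \<xi> *\<^sub>R character k \<xi>)
    = (if k = 0 then (2 * complex_of_real pi) ^ CARD('d) else 0)"
proof -
  interpret product_sigma_finite "\<lambda>_::real^'d. lborel :: real measure" by unfold_locales
  define m where "m b = floor (real_vec k \<bullet> b)" for b :: "real^'d"
  have m: "m (axis i 1) = k $ i" for i
    by (simp add: m_def inner_axis real_vec_def)
  let ?f = "\<lambda>b y. indicator {a..a + 2 * pi} y *\<^sub>R exp (\<i> * complex_of_real (real_of_int (m b) * y))"
  have prod: "indicator (period_cube a) \<xi> *\<^sub>R character k \<xi> = (\<Prod>b\<in>Basis. ?f b (\<xi> \<bullet> b))" for \<xi> :: "real^'d"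
  proof -
    have "indicator (period_cube a) \<xi> = (\<Prod>i\<in>UNIV. indicator {a..a + 2 * pi} (\<xi> $ i) :: real)"
      by (auto simp: indicator_def mem_period_cube prod_zero_iff)
    moreover have "character k \<xi> = (\<Prod>i\<in>UNIV. exp (\<i> * complex_of_real (real_of_int (k $ i) * \<xi> $ i)))"
      by (simp add: exp_sum[symmetric] inner_vec_def real_vec_def sum_distrib_left)
    ultimately show ?thesis
      by (simp add: prod_Basis_vec m inner_axis scaleR_conv_of_real prod.distrib)
  qed
  have im: "(\<lambda>f. \<Sum>b\<in>Basis. f b *\<^sub>R b) \<in> borel_measurable (\<Pi>\<^sub>M b\<in>(Basis::(real^'d) set). lborel)"
    by measurable
  have "(LINT \<xi>|lborel. indicator (period_cube a) \<xi> *\<^sub>R character k \<xi>)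
     = (LINT \<xi>|lborel. (\<Prod>b\<in>Basis. ?f b (\<xi> \<bullet> b)))"
    by (simp only: prod)
  also have "\<dots> = (LINT x|(\<Pi>\<^sub>M b\<in>Basis. lborel). (\<Prod>b\<in>Basis. ?f b ((\<Sum>b\<in>Basis. x b *\<^sub>R b) \<bullet> b)))"
    by (subst lborel_eq) (intro integral_distr im, measurable)
  also have "\<dots> = (LINT x|(\<Pi>\<^sub>M b\<in>Basis. lborel). (\<Prod>b\<in>(Basis::(real^'d) set). ?f b (x b)))"
    by (intro Bochner_Integration.integral_cong prod.cong refl) (simp add: inner_sum_left_Basis)
  also have "\<dots> = (\<Prod>b\<in>(Basis::(real^'d) set). LINT y|lborel. ?f b y)"
    by (intro product_integral_prod borel_integrable_compact continuous_intros finite_Basis compact_Icc)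
  also have "\<dots> = (\<Prod>i\<in>(UNIV::'d set). if k $ i = 0 then 2 * complex_of_real pi else 0)"
    by (simp only: integral_exp_period prod_Basis_vec m)
  also have "\<dots> = (if k = 0 then (2 * complex_of_real pi) ^ CARD('d) else 0)"
    by (auto simp: vec_eq_iff)
  finally show ?thesis .
qed

text \<open>
  Induction on \<open>n\<close>: expanding one factor of \<open>f(\<xi>)^(n+1)\<close> as a Fourier series and integrating term by
  term turns the inversion integral for \<open>n + 1\<close> into a convolution of those for \<open>n\<close>.  The case
  \<open>n = 1\<close> is orthogonality of characters.
\<close>

lemma conv_power_eq_integral:
  fixes \<phi> :: "int^'d \<Rightarrow> complex"
  assumes \<phi>: "(\<lambda>x. norm (\<phi> x)) summable_on UNIV" and n: "n > 0"
  shows "(2 * complex_of_real pi) ^ CARD('d) * conv_power \<phi> n x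
    = (LINT \<xi>|lborel. indicator (period_cube a) \<xi> *\<^sub>R (fourier \<phi> \<xi> ^ n * character (- x) \<xi>))"
  using n
proof (induction n arbitrary: x)
  case 0
  then show ?case by simp
next
  case (Suc n)
  let ?C = "(2 * complex_of_real pi) ^ CARD('d)"
  let ?Q = "period_cube a :: (real^'d) set"
  have add: "character (x + y) \<xi> = character x \<xi> * character y \<xi>" for x y :: "int^'d" and \<xi>
  proof -
    have "real_vec (x + y) = real_vec x + real_vec y"
      by (simp add: real_vec_def vec_eq_iff)
    then show ?thesis by (simp add: inner_add_left distrib_left exp_add)
  qed
  have step: "((\<lambda>y. \<phi> y * (LINT \<xi>|lborel. indicator ?Q \<xi> *\<^sub>R (fourier \<phi> \<xi> ^ j * character (y - x) \<xi>))) has_sum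
      (LINT \<xi>|lborel. indicator ?Q \<xi> *\<^sub>R (fourier \<phi> \<xi> ^ Suc j * character (- x) \<xi>))) UNIV" for j
  proof -
    have "integrable lborel (\<lambda>\<xi>. indicator ?Q \<xi> *\<^sub>R (fourier \<phi> \<xi> ^ j * character (- x) \<xi>))"
      unfolding period_cube_def
      by (intro borel_integrable_compact compact_cbox continuous_intros continuous_on_subset[OF continuous_fourier[OF \<phi>]] subset_UNIV)
    from integral_mult_fourier[OF \<phi> this] show ?thesis
      using add[of "- x"] by (simp add: mult_ac)
  qed
  show ?case
  proof (cases "n = 0")
    case True
    have "((\<lambda>y. \<phi> y * (if y - x = 0 then ?C else 0)) has_sum
      (LINT \<xi>|lborel. indicator ?Q \<xi> *\<^sub>R (fourier \<phi> \<xi> ^ Suc 0 * character (- x) \<xi>))) UNIV"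
      using step[of 0] by (simp add: integral_character_cube del: right_minus_eq)
    moreover have "((\<lambda>y. \<phi> y * (if y - x = 0 then ?C else 0)) has_sum ?C * \<phi> x) UNIV"
      by (rule has_sum_finite_neutralI[of "{x}"]) auto
    ultimately show ?thesis
      using True by (auto dest: has_sum_unique)
  next
    case False
    have "conv_power \<phi> (Suc n) = convolution (conv_power \<phi> n) \<phi>"
      using False by (cases n) auto
    then have "?C * conv_power \<phi> (Suc n) x = (\<Sum>\<^sub>\<infinity>y. \<phi> y * (?C * conv_power \<phi> n (x - y)))"
      by (simp add: convolution_def infsum_cmult_right'[symmetric] mult_ac)
    also have "\<dots> = (\<Sum>\<^sub>\<infinity>y. \<phi> y * (LINT \<xi>|lborel. indicator ?Q \<xi> *\<^sub>R (fourier \<phi> \<xi> ^ n * character (y - x) \<xi>)))"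
      using False by (simp only: Suc.IH neq0_conv minus_diff_eq)
    also have "\<dots> = (LINT \<xi>|lborel. indicator ?Q \<xi> *\<^sub>R (fourier \<phi> \<xi> ^ Suc n * character (- x) \<xi>))"
      by (rule infsumI) (rule step)
    finally show ?thesis .
  qed
qed

section \<open>Points of positive homogeneous type\<close>

lemma real_vec_uminus: "real_vec (- x) = - real_vec x"
  by (simp add: real_vec_def vec_eq_iff)

lemma pos_hom_expansion_drift:
  assumes "pos_hom_type \<phi> \<eta>"
  shows "pos_hom_expansion \<phi> \<eta> (drift \<phi> \<eta>) (hom_poly \<phi> \<eta>)"
proof -
  have "\<exists>p. case p of (\<alpha>, P) \<Rightarrow> pos_hom_expansion \<phi> \<eta> \<alpha> P"
    using assms by (auto simp: pos_hom_type_def)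
  then have "case drift_poly \<phi> \<eta> of (\<alpha>, P) \<Rightarrow> pos_hom_expansion \<phi> \<eta> \<alpha> P"
    unfolding drift_poly_def by (rule someI_ex)
  then show ?thesis by (simp add: drift_def hom_poly_def case_prod_beta)
qed

lemma homogeneous_symbol_SOME_exponent:
  assumes "positive_homogeneous P"
  shows "homogeneous_symbol P (SOME E. E \<in> Expo P)"
proof
  let ?E = "SOME E. E \<in> Expo P"
  have E: "?E \<in> Expo P"
    using assms by (intro someI_ex[where P = "\<lambda>E. E \<in> Expo P"]) (auto simp: positive_homogeneous_def)
  show "P (mat_exp (s *\<^sub>R ?E) *v \<xi>) = complex_of_real (exp s) * P \<xi>" for s \<xi>
  proof -
    have "\<forall>t>0. \<forall>\<xi>. complex_of_real t * P \<xi> = P (mat_powr t ?E *v \<xi>)"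
      using E unfolding Expo_def by blast
    from this[rule_format, of "exp s" \<xi>] show ?thesis by (simp add: mat_powr_def)
  qed
qed (use assms in \<open>auto simp: positive_homogeneous_def\<close>)

text \<open>
  Near \<open>0\<close> the quotient is nonzero, so \<open>exp\<close> undoes the logarithm in \<open>Gam\<close>; the remainder, being
  \<open>o(R)\<close>, is at most \<open>R / 2\<close> on small balls.
\<close>

lemma local_expansion_at:
  fixes \<phi> :: "int^'d \<Rightarrow> complex"
  assumes \<phi>: "(\<lambda>x. norm (\<phi> x)) summable_on UNIV"
    and type: "pos_hom_type \<phi> \<eta>" and nz: "fourier \<phi> \<eta> \<noteq> 0"
  defines "P \<equiv> hom_poly \<phi> \<eta>" and "\<alpha> \<equiv> drift \<phi> \<eta>"
  shows "\<forall>\<^sub>F r in at_right 0. local_expansion P (SOME E. E \<in> Expo P) (ball 0 r)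
     (\<lambda>\<xi>. fourier \<phi> (\<xi> + \<eta>) / fourier \<phi> \<eta>)
     (\<lambda>\<xi>. Gam \<phi> \<eta> \<xi> - (\<i> * complex_of_real (\<alpha> \<bullet> \<xi>) - P \<xi>)) \<alpha>"
proof -
  let ?E = "SOME E. E \<in> Expo P"
  let ?h = "\<lambda>\<xi>. fourier \<phi> (\<xi> + \<eta>) / fourier \<phi> \<eta>"
  let ?Y = "\<lambda>\<xi>. Gam \<phi> \<eta> \<xi> - (\<i> * complex_of_real (\<alpha> \<bullet> \<xi>) - P \<xi>)"
  have ex: "pos_hom_expansion \<phi> \<eta> \<alpha> P"
    unfolding P_def \<alpha>_def by (rule pos_hom_expansion_drift[OF type])
  then interpret homogeneous_symbol P ?E
    by (intro homogeneous_symbol_SOME_exponent) (simp add: pos_hom_expansion_def)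
  have o: "?Y \<in> o[at 0](\<lambda>\<xi>. complex_of_real (Re (P \<xi>)))"
    using ex by (simp add: pos_hom_expansion_def)
  have ch: "continuous_on UNIV ?h"
    using nz by (intro continuous_intros continuous_on_compose2[OF continuous_fourier[OF \<phi>]]) auto
  have "isCont ?h 0"
    using ch by (simp add: continuous_on_eq_continuous_at)
  then have "?h \<midarrow>0\<rightarrow> ?h 0" by (simp only: isCont_def)
  moreover have "?h 0 \<noteq> 0" using nz by simp
  ultimately have ev1: "\<forall>\<^sub>F \<xi> in at 0. ?h \<xi> \<noteq> 0"
    by (rule tendsto_imp_eventually_ne)
  have "\<forall>\<^sub>F \<xi> in at 0. norm (?Y \<xi>) \<le> (1/2) * norm (complex_of_real (Re (P \<xi>)))"
    by (rule landau_o.smallD[OF o]) simp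
  with ev1 have "\<forall>\<^sub>F \<xi> in at 0. ?h \<xi> \<noteq> 0 \<and> norm (?Y \<xi>) \<le> Re (P \<xi>) / 2"
    by eventually_elim (use nonneg in auto)
  then obtain r0 where r0: "r0 > 0" "\<And>\<xi>. \<xi> \<noteq> 0 \<Longrightarrow> dist \<xi> 0 < r0 \<Longrightarrow> ?h \<xi> \<noteq> 0 \<and> norm (?Y \<xi>) \<le> Re (P \<xi>) / 2"
    unfolding eventually_at by blast
  have good: "?h \<xi> \<noteq> 0 \<and> norm (?Y \<xi>) \<le> Re (P \<xi>) / 2" if "norm \<xi> < r0" for \<xi>
  proof (cases "\<xi> = 0")
    case True
    then show ?thesis using nz by (simp add: P_0 Gam_def)
  next
    case False
    then show ?thesis using r0(2)[OF False] that by simp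
  qed
  have "local_expansion P ?E (ball 0 r) ?h ?Y \<alpha>" if r: "0 < r" "r < r0" for r
  proof
    show "?h \<in> borel_measurable borel"
      by (intro borel_measurable_continuous_onI ch)
    show "?h \<xi> = exp (\<i> * complex_of_real (\<alpha> \<bullet> \<xi>) - P \<xi> + ?Y \<xi>)" if "\<xi> \<in> ball 0 r" for \<xi>
    proof -
      have "?h \<xi> \<noteq> 0" using good[of \<xi>] that r by simp
      then have "exp (Gam \<phi> \<eta> \<xi>) = ?h \<xi>" unfolding Gam_def by (rule exp_Ln)
      then show ?thesis by simp
    qed
    show "norm (?Y \<xi>) \<le> Re (P \<xi>) / 2" if "\<xi> \<in> ball 0 r" for \<xi>
      using good[of \<xi>] that r by simp
  qed (use r o in auto)
  then show ?thesis
    unfolding eventually_at_right_field using r0(1) by blast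
qed

lemma integral_translate:
  fixes g :: "'a::euclidean_space \<Rightarrow> 'b::{banach,second_countable_topology}"
  assumes [measurable]: "g \<in> borel_measurable borel"
  shows "(LINT \<xi>|lborel. g \<xi>) = (LINT \<xi>|lborel. g (\<xi> + c))"
  by (subst lborel_distr_plus[symmetric, of c]) (simp add: integral_distr add.commute)

text \<open>
  Translating \<open>\<eta>\<close> to the origin splits off \<open>f(\<eta>)^n e^(-i x \<cdot> \<eta>)\<close>, which has modulus one.  The error
  bound \<open>D n\<close> is the integral of the discrepancy and does not depend on \<open>x\<close>.
\<close>

lemma local_contribution:
  fixes \<phi> :: "int^'d \<Rightarrow> complex"
  assumes \<phi>: "(\<lambda>x. norm (\<phi> x)) summable_on UNIV"
    and type: "pos_hom_type \<phi> \<eta>" and unit: "norm (fourier \<phi> \<eta>) = 1"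
  defines "P \<equiv> hom_poly \<phi> \<eta>"
  shows "\<forall>\<^sub>F r in at_right 0.
     (\<forall>\<xi>\<in>ball \<eta> r. \<xi> \<noteq> \<eta> \<longrightarrow> norm (fourier \<phi> \<xi>) < 1) \<and>
     (\<exists>D. (\<lambda>n. real n powr hom_order P * D n) \<longlonglongrightarrow> 0 \<and>
        (\<forall>n>0. \<forall>x. norm ((LINT \<xi>|lborel. indicator (ball \<eta> r) \<xi> *\<^sub>R (fourier \<phi> \<xi> ^ n * character (- x) \<xi>))
           - exp (- \<i> * complex_of_real (real_vec x \<bullet> \<eta>)) * fourier \<phi> \<eta> ^ n *
             ((2 * complex_of_real pi) ^ CARD('d) *
              heat_kernel P (real n) (real_vec x - real n *\<^sub>R drift \<phi> \<eta>))) \<le> D n))"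
proof -
  have nz: "fourier \<phi> \<eta> \<noteq> 0" using unit by auto
  let ?h = "\<lambda>\<xi>. fourier \<phi> (\<xi> + \<eta>) / fourier \<phi> \<eta>"
  show ?thesis
    using local_expansion_at[OF \<phi> type nz, folded P_def]
  proof eventually_elim
    case (elim r)
    then interpret local_expansion P "SOME E. E \<in> Expo P" "ball 0 r" ?h
      "\<lambda>\<xi>. Gam \<phi> \<eta> \<xi> - (\<i> * complex_of_real (drift \<phi> \<eta> \<bullet> \<xi>) - P \<xi>)" "drift \<phi> \<eta>" .
    have "norm (fourier \<phi> \<xi>) < 1" if "\<xi> \<in> ball \<eta> r" "\<xi> \<noteq> \<eta>" for \<xi>
    proof -
      have "\<xi> - \<eta> \<in> ball 0 r" using that by (simp add: dist_norm norm_minus_commute)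
      then have "norm (?h (\<xi> - \<eta>) ^ 1) \<le> exp (- (real 1 * Re (P (\<xi> - \<eta>)) / 2))"
        by (rule norm_h_power)
      also have "\<dots> < 1" using R_pos[of "\<xi> - \<eta>"] that by simp
      finally show ?thesis using unit by (simp add: norm_divide)
    qed
    moreover have "\<exists>D. (\<lambda>n. real n powr hom_order P * D n) \<longlonglongrightarrow> 0 \<and>
        (\<forall>n>0. \<forall>x. norm ((LINT \<xi>|lborel. indicator (ball \<eta> r) \<xi> *\<^sub>R (fourier \<phi> \<xi> ^ n * character (- x) \<xi>))
           - exp (- \<i> * complex_of_real (real_vec x \<bullet> \<eta>)) * fourier \<phi> \<eta> ^ n *
             ((2 * complex_of_real pi) ^ CARD('d) *
              heat_kernel P (real n) (real_vec x - real n *\<^sub>R drift \<phi> \<eta>))) \<le> D n)"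
    proof (intro exI[of _ "\<lambda>n. LINT \<xi>|lborel. discrepancy n \<xi>"] conjI allI impI)
      show "(\<lambda>n. real n powr hom_order P * (LINT \<xi>|lborel. discrepancy n \<xi>)) \<longlonglongrightarrow> 0"
        unfolding hom_order_def by (rule discrepancy_integral_tendsto_0)
      fix n :: nat and x :: "int^'d" assume n: "n > 0"
      let ?c = "exp (- \<i> * complex_of_real (real_vec x \<bullet> \<eta>)) * fourier \<phi> \<eta> ^ n"
      let ?L = "LINT \<xi>|lborel. indicator (ball 0 r) \<xi> *\<^sub>R (?h \<xi> ^ n * exp (- \<i> * complex_of_real (real_vec x \<bullet> \<xi>)))"
      let ?H = "(2 * complex_of_real pi) ^ CARD('d) * heat_kernel P (real n) (real_vec x - real n *\<^sub>R drift \<phi> \<eta>)"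
      have c: "norm ?c = 1" using unit by (simp add: norm_mult norm_power)
      have "(LINT \<xi>|lborel. indicator (ball \<eta> r) \<xi> *\<^sub>R (fourier \<phi> \<xi> ^ n * character (- x) \<xi>))
         = (LINT \<xi>|lborel. indicator (ball \<eta> r) (\<xi> + \<eta>) *\<^sub>R (fourier \<phi> (\<xi> + \<eta>) ^ n * character (- x) (\<xi> + \<eta>)))"
        by (intro integral_translate borel_measurable_scaleR borel_measurable_indicator
            borel_measurable_continuous_onI continuous_intros continuous_fourier \<phi>) auto
      also have "\<dots> = (LINT \<xi>|lborel. ?c * (indicator (ball 0 r) \<xi> *\<^sub>R (?h \<xi> ^ n * exp (- \<i> * complex_of_real (real_vec x \<bullet> \<xi>)))))"
      proof (rule Bochner_Integration.integral_cong[OF refl])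
        fix \<xi>
        have "indicator (ball \<eta> r) (\<xi> + \<eta>) = (indicator (ball 0 r) \<xi> :: real)"
          by (simp add: indicator_def dist_norm)
        moreover have "character (- x) (\<xi> + \<eta>) = exp (- \<i> * complex_of_real (real_vec x \<bullet> \<eta>)) * exp (- \<i> * complex_of_real (real_vec x \<bullet> \<xi>))"
          unfolding exp_add[symmetric] by (simp add: real_vec_uminus inner_add_right algebra_simps)
        moreover have "fourier \<phi> (\<xi> + \<eta>) ^ n = fourier \<phi> \<eta> ^ n * ?h \<xi> ^ n"
          using nz by (simp add: power_divide)
        ultimately show "indicator (ball \<eta> r) (\<xi> + \<eta>) *\<^sub>R (fourier \<phi> (\<xi> + \<eta>) ^ n * character (- x) (\<xi> + \<eta>))
          = ?c * (indicator (ball 0 r) \<xi> *\<^sub>R (?h \<xi> ^ n * exp (- \<i> * complex_of_real (real_vec x \<bullet> \<xi>))))"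
          by (simp only: scaleR_conv_of_real mult_ac)
      qed
      also have "\<dots> = ?c * ?L"
        by (rule integral_mult_right_zero)
      finally have "norm ((LINT \<xi>|lborel. indicator (ball \<eta> r) \<xi> *\<^sub>R (fourier \<phi> \<xi> ^ n * character (- x) \<xi>)) - ?c * ?H)
          = norm ?c * norm (?L - ?H)"
        by (simp only: right_diff_distrib norm_mult[symmetric])
      also have "\<dots> \<le> (LINT \<xi>|lborel. discrepancy n \<xi>)"
        unfolding c using local_error[OF n, of "real_vec x"] by simp
      finally show "norm ((LINT \<xi>|lborel. indicator (ball \<eta> r) \<xi> *\<^sub>R (fourier \<phi> \<xi> ^ n * character (- x) \<xi>)) - ?c * ?H)
         \<le> (LINT \<xi>|lborel. discrepancy n \<xi>)" .
    qed
    ultimately show ?case by blast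
  qed
qed

lemma heat_kernel_hom_poly_bound:
  fixes \<phi> :: "int^'d \<Rightarrow> complex"
  assumes "pos_hom_type \<phi> \<eta>"
  shows "\<exists>C. \<forall>n>0. \<forall>x. norm ((2 * complex_of_real pi) ^ CARD('d) * heat_kernel (hom_poly \<phi> \<eta>) n x)
     \<le> C * n powr (- hom_order (hom_poly \<phi> \<eta>))"
proof -
  interpret homogeneous_symbol "hom_poly \<phi> \<eta>" "SOME E. E \<in> Expo (hom_poly \<phi> \<eta>)"
    using pos_hom_expansion_drift[OF assms]
    by (intro homogeneous_symbol_SOME_exponent) (simp add: pos_hom_expansion_def)
  show ?thesis
    unfolding hom_order_def using heat_kernel_bound by blast
qed

lemma exists_torus_representative: "\<exists>k. \<xi> + (2 * pi) *\<^sub>R real_vec k \<in> torus"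
proof -
  define k where "k = (\<chi> i. - \<lceil>(\<xi> $ i - pi) / (2 * pi)\<rceil>)"
  have "- pi < \<xi> $ i + 2 * pi * real_of_int (k $ i) \<and> \<xi> $ i + 2 * pi * real_of_int (k $ i) \<le> pi" for i
  proof -
    \<comment> \<open>The rounding is chosen so that the upper end of the half-open interval is included.\<close>
    define c where "c = \<lceil>(\<xi> $ i - pi) / (2 * pi)\<rceil>"
    have "(\<xi> $ i - pi) / (2 * pi) \<le> real_of_int c" "real_of_int c < (\<xi> $ i - pi) / (2 * pi) + 1"
      unfolding c_def by linarith+
    then have "\<xi> $ i - pi \<le> real_of_int c * (2 * pi)" "real_of_int c * (2 * pi) < \<xi> $ i - pi + 2 * pi"
      by (simp_all add: field_simps)
    moreover have "k $ i = - c" by (simp add: k_def c_def)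
    ultimately show ?thesis by (simp add: algebra_simps)
  qed
  then show ?thesis by (intro exI[of _ k]) (simp add: torus_def real_vec_def)
qed

text \<open>
  The set \<open>|f| = 1\<close> is closed and periodic, and each of its points is isolated because, after
  translation into the torus, it is of positive homogeneous type.  A compact cube contains only
  finitely many such points.
\<close>

lemma finite_Omega:
  fixes \<phi> :: "int^'d \<Rightarrow> complex"
  assumes \<phi>: "(\<lambda>x. norm (\<phi> x)) summable_on UNIV"
    and type: "\<forall>\<eta>\<in>Omega \<phi>. pos_hom_type \<phi> \<eta>"
  shows "finite (Omega \<phi>)"
proof -
  let ?B = "{\<xi>. norm (fourier \<phi> \<xi>) = 1}"
  have "finite (period_cube (- pi) \<inter> ?B)"
  proof (rule finite_not_islimpt_in_compact)
    show "compact (period_cube (- pi) :: (real^'d) set)" by (simp add: period_cube_def)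
    fix z :: "real^'d"
    show "\<not> z islimpt ?B"
    proof
      assume z: "z islimpt ?B"
      have "closed ?B"
        by (intro closed_Collect_eq continuous_intros continuous_fourier \<phi>)
      then have "z \<in> ?B" using z by (rule closed_limpt[THEN iffD1, rule_format])
      obtain k where k: "z + (2 * pi) *\<^sub>R real_vec k \<in> torus"
        using exists_torus_representative by blast
      let ?s = "(2 * pi) *\<^sub>R real_vec k :: real^'d"
      have "z + ?s \<in> Omega \<phi>"
        using k \<open>z \<in> ?B\<close> by (simp add: Omega_def fourier_periodic)
      then have "pos_hom_type \<phi> (z + ?s)" "norm (fourier \<phi> (z + ?s)) = 1"
        using type by (auto simp: Omega_def)
      from local_contribution[OF \<phi> this]
      have "\<forall>\<^sub>F r in at_right 0. r > 0 \<and> (\<forall>\<xi>\<in>ball (z + ?s) r. \<xi> \<noteq> z + ?s \<longrightarrow> norm (fourier \<phi> \<xi>) < 1)"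
        using eventually_at_right_less[of 0] by eventually_elim blast
      then obtain r where r: "r > 0" "\<And>\<xi>. \<xi> \<in> ball (z + ?s) r \<Longrightarrow> \<xi> \<noteq> z + ?s \<Longrightarrow> norm (fourier \<phi> \<xi>) < 1"
        using eventually_happens'[OF trivial_limit_at_right_real] by blast
      from z r(1) obtain y where y: "y \<in> ?B" "y \<noteq> z" "dist y z < r"
        unfolding islimpt_approachable by blast
      then have "norm (fourier \<phi> (y + ?s)) < 1"
        by (intro r(2)) (auto simp: dist_commute)
      then show False using y(1) by (simp add: fourier_periodic)
    qed
  qed
  moreover have "Omega \<phi> \<subseteq> period_cube (- pi) \<inter> ?B"
    by (auto simp: Omega_def torus_def mem_period_cube less_imp_le)
  ultimately show ?thesis by (rule rev_finite_subset)
qed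

section \<open>Decomposition of the inversion integral\<close>

text \<open>
  Points of \<open>Omega \<phi>\<close> may lie on the faces \<open>\<xi>\<^sub>i = \<pi>\<close> of the torus but never on \<open>\<xi>\<^sub>i = - \<pi>\<close>.
  Shifting the cube slightly upwards along the diagonal moves all of them into its interior, and
  periodicity shows that no further points with \<open>|f| = 1\<close> enter.
\<close>

lemma exists_cube_avoiding_boundary:
  fixes \<phi> :: "int^'d \<Rightarrow> complex"
  assumes "finite (Omega \<phi>)"
  obtains a where "Omega \<phi> \<subseteq> interior (period_cube a)"
    and "\<And>\<xi>. \<xi> \<in> period_cube a \<Longrightarrow> norm (fourier \<phi> \<xi>) = 1 \<Longrightarrow> \<xi> \<in> Omega \<phi>"
proof -
  have "\<forall>\<^sub>F \<delta> in at_right (0::real). \<delta> \<in> {0<..<pi} \<and> (\<forall>\<eta>\<in>Omega \<phi>. \<forall>i. - pi + \<delta> < \<eta> $ i)"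
  proof (intro eventually_conj eventually_ball_finite[OF assms] ballI eventually_all_finite eventually_at_right_real pi_gt_zero)
    fix \<eta> i assume "\<eta> \<in> Omega \<phi>"
    then have "0 < \<eta> $ i + pi" by (auto simp: Omega_def torus_def dest: spec[of _ i])
    from eventually_at_right_real[OF this]
    show "\<forall>\<^sub>F \<delta> in at_right 0. - pi + \<delta> < \<eta> $ i"
      by eventually_elim auto
  qed
  then obtain \<delta> where \<delta>: "\<delta> > 0" "\<delta> < pi" "\<And>\<eta> i. \<eta> \<in> Omega \<phi> \<Longrightarrow> - pi + \<delta> < \<eta> $ i"
    using eventually_happens'[OF trivial_limit_at_right_real[of 0]] by force
  let ?a = "- pi + \<delta>"
  show ?thesis
  proof (rule that[of ?a])
    show "Omega \<phi> \<subseteq> interior (period_cube ?a)"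
    proof
      fix \<eta> assume \<eta>: "\<eta> \<in> Omega \<phi>"
      have "\<eta> $ i \<le> pi" for i using \<eta> by (simp add: Omega_def torus_def)
      then have "\<eta> $ i < ?a + 2 * pi" for i
        using \<delta>(1) order_le_less_trans[of "\<eta> $ i" pi "?a + 2 * pi"] by simp
      then show "\<eta> \<in> interior (period_cube ?a)"
        using \<delta>(3)[OF \<eta>] by (simp add: period_cube_def interior_cbox mem_box_cart)
    qed
    fix \<xi> :: "real^'d" assume \<xi>: "\<xi> \<in> period_cube ?a" "norm (fourier \<phi> \<xi>) = 1"
    \<comment> \<open>Reducing \<open>\<xi>\<close> to the torus lowers the coordinates above \<open>\<pi>\<close> by \<open>2 \<pi>\<close>, into the strip next to
        \<open>- \<pi>\<close> that contains no coordinate of a point of \<open>Omega \<phi>\<close>; hence there are none.\<close>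
    define k :: "int^'d" where "k = (\<chi> i. if \<xi> $ i > pi then - 1 else 0)"
    let ?\<eta> = "\<xi> + (2 * pi) *\<^sub>R real_vec k"
    have \<eta>i: "?\<eta> $ i = (if \<xi> $ i > pi then \<xi> $ i - 2 * pi else \<xi> $ i)" for i
      by (simp add: k_def real_vec_def)
    have b: "?a \<le> \<xi> $ i" "\<xi> $ i \<le> pi + \<delta>" for i
      using \<xi>(1) unfolding mem_period_cube by (simp, drule_tac x = i in spec, simp)
    have "?\<eta> \<in> torus"
      unfolding torus_def mem_Collect_eq \<eta>i
    proof
      fix i
      show "- pi < (if \<xi> $ i > pi then \<xi> $ i - 2 * pi else \<xi> $ i) \<and>
          (if \<xi> $ i > pi then \<xi> $ i - 2 * pi else \<xi> $ i) \<le> pi"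
        using b[of i] \<delta>(1,2) pi_gt_zero by (cases "\<xi> $ i > pi") (simp_all only: if_True if_False, linarith+)
    qed
    then have \<Omega>: "?\<eta> \<in> Omega \<phi>"
      using \<xi>(2) by (simp add: Omega_def fourier_periodic)
    have "\<not> \<xi> $ i > pi" for i
      using \<delta>(3)[OF \<Omega>, of i] b[of i] unfolding \<eta>i by (auto split: if_splits)
    then have "?\<eta> = \<xi>" unfolding vec_eq_iff \<eta>i by simp
    with \<Omega> show "\<xi> \<in> Omega \<phi>" by simp
  qed
qed

lemma powr_mult_power_tendsto_0:
  fixes m \<rho> :: real
  assumes "0 < \<rho>" "\<rho> < 1"
  shows "(\<lambda>n. real n powr m * \<rho> ^ n) \<longlonglongrightarrow> 0"
proof -
  have "(\<lambda>n. real n powr m * exp (- (l * real n))) \<longlonglongrightarrow> 0" if "l > 0" for l :: real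
    using that by real_asymp
  from this[of "- ln \<rho>"]
  have "(\<lambda>n. real n powr m * exp (- (- ln \<rho> * real n))) \<longlonglongrightarrow> 0"
    using assms by simp
  moreover have "exp (- (- ln \<rho> * real n)) = \<rho> ^ n" for n
    using assms by (simp add: exp_of_nat2_mult)
  ultimately show ?thesis by simp
qed

text \<open>
  The cube is split into disjoint small balls about the points of \<open>Omega \<phi>\<close> and a compact rest on
  which \<open>|f| \<le> \<rho> < 1\<close>.
\<close>

lemma conv_power_local_decomposition:
  fixes \<phi> :: "int^'d \<Rightarrow> complex"
  assumes \<phi>: "(\<lambda>x. norm (\<phi> x)) summable_on UNIV"
    and le_1: "\<And>\<xi>. norm (fourier \<phi> \<xi>) \<le> 1"
    and type: "\<forall>\<eta>\<in>Omega \<phi>. pos_hom_type \<phi> \<eta>"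
  obtains D \<rho> V where "0 < \<rho>" "\<rho> < (1::real)"
    and "\<And>\<eta>. \<eta> \<in> Omega \<phi> \<Longrightarrow> (\<lambda>n. real n powr hom_order (hom_poly \<phi> \<eta>) * D \<eta> n) \<longlonglongrightarrow> 0"
    and "\<And>n x. n > 0 \<Longrightarrow> norm ((2 * complex_of_real pi) ^ CARD('d) * conv_power \<phi> n x
        - (\<Sum>\<eta>\<in>Omega \<phi>. exp (- \<i> * complex_of_real (real_vec x \<bullet> \<eta>)) * fourier \<phi> \<eta> ^ n *
             ((2 * complex_of_real pi) ^ CARD('d) *
              heat_kernel (hom_poly \<phi> \<eta>) (real n) (real_vec x - real n *\<^sub>R drift \<phi> \<eta>))))
        \<le> (\<Sum>\<eta>\<in>Omega \<phi>. D \<eta> n) + V * \<rho> ^ n"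
proof -
  have fin: "finite (Omega \<phi>)" by (rule finite_Omega[OF \<phi> type])
  obtain a where a: "Omega \<phi> \<subseteq> interior (period_cube a)"
    "\<And>\<xi>. \<xi> \<in> period_cube a \<Longrightarrow> norm (fourier \<phi> \<xi>) = 1 \<Longrightarrow> \<xi> \<in> Omega \<phi>"
    by (rule exists_cube_avoiding_boundary[OF fin]) (rule that)
  define Q :: "(real^'d) set" where "Q = period_cube a"
  have Q: "compact Q" by (simp add: Q_def period_cube_def)
  define T where "T \<eta> n x = exp (- \<i> * complex_of_real (real_vec x \<bullet> \<eta>)) * fourier \<phi> \<eta> ^ n *
             ((2 * complex_of_real pi) ^ CARD('d) *
              heat_kernel (hom_poly \<phi> \<eta>) (real n) (real_vec x - real n *\<^sub>R drift \<phi> \<eta>))"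
    for \<eta> :: "real^'d" and n :: nat and x :: "int^'d"
  define F where "F n x \<xi> = fourier \<phi> \<xi> ^ n * character (- x) \<xi>" for n and x :: "int^'d" and \<xi> :: "real^'d"
  define G where "G \<eta> r D \<longleftrightarrow> (\<lambda>n. real n powr hom_order (hom_poly \<phi> \<eta>) * D n) \<longlonglongrightarrow> 0 \<and>
      (\<forall>n>0. \<forall>x. norm ((LINT \<xi>|lborel. indicator (ball \<eta> r) \<xi> *\<^sub>R F n x \<xi>) - T \<eta> n x) \<le> D n)"
    for \<eta> r and D :: "nat \<Rightarrow> real"
  have "\<forall>\<^sub>F r in at_right 0. \<forall>\<eta>\<in>Omega \<phi>. \<exists>D. G \<eta> r D"
  proof (rule eventually_ball_finite[OF fin], rule ballI)
    fix \<eta> assume "\<eta> \<in> Omega \<phi>"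
    then have "pos_hom_type \<phi> \<eta>" "norm (fourier \<phi> \<eta>) = 1"
      using type by (auto simp: Omega_def)
    from local_contribution[OF \<phi> this]
    show "\<forall>\<^sub>F r in at_right 0. \<exists>D. G \<eta> r D"
      unfolding G_def T_def F_def by (rule eventually_mono) (erule conjunct2)
  qed
  moreover have "\<forall>\<^sub>F r in at_right 0. \<forall>\<eta>\<in>Omega \<phi>. ball \<eta> r \<subseteq> Q"
  proof (rule eventually_ball_finite[OF fin], rule ballI)
    fix \<eta> assume "\<eta> \<in> Omega \<phi>"
    then have "\<eta> \<in> interior Q" using a(1) by (auto simp: Q_def)
    then obtain e where e: "e > 0" "ball \<eta> e \<subseteq> Q"
      by (auto simp: mem_interior)
    from eventually_at_right_real[OF e(1)]
    show "\<forall>\<^sub>F r in at_right 0. ball \<eta> r \<subseteq> Q"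
    proof eventually_elim
      case (elim r)
      then have "ball \<eta> r \<subseteq> ball \<eta> e" by (intro subset_ball) simp
      then show ?case using e(2) by (rule subset_trans)
    qed
  qed
  moreover have "\<forall>\<^sub>F r in at_right 0. \<forall>\<eta>\<in>Omega \<phi>. \<forall>\<eta>'\<in>Omega \<phi>. \<eta> \<noteq> \<eta>' \<longrightarrow> ball \<eta> r \<inter> ball \<eta>' r = {}"
  proof (rule eventually_ball_finite[OF fin], rule ballI, rule eventually_ball_finite[OF fin], rule ballI)
    fix \<eta> \<eta>' :: "real^'d"
    show "\<forall>\<^sub>F r in at_right 0. \<eta> \<noteq> \<eta>' \<longrightarrow> ball \<eta> r \<inter> ball \<eta>' r = {}"
    proof (cases "\<eta> = \<eta>'")
      case False
      then have "0 < dist \<eta> \<eta>' / 2" by simp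
      from eventually_at_right_real[OF this] show ?thesis
        by eventually_elim (auto intro!: disjoint_ballI)
    qed simp
  qed
  ultimately have "\<forall>\<^sub>F r in at_right 0. r > 0 \<and> (\<forall>\<eta>\<in>Omega \<phi>. \<exists>D. G \<eta> r D) \<and> (\<forall>\<eta>\<in>Omega \<phi>. ball \<eta> r \<subseteq> Q) \<and>
     (\<forall>\<eta>\<in>Omega \<phi>. \<forall>\<eta>'\<in>Omega \<phi>. \<eta> \<noteq> \<eta>' \<longrightarrow> ball \<eta> r \<inter> ball \<eta>' r = {})"
    by (intro eventually_conj eventually_at_right_less)
  from eventually_happens'[OF trivial_limit_at_right_real this]
  obtain r where r: "r > 0" "\<forall>\<eta>\<in>Omega \<phi>. \<exists>D. G \<eta> r D" "\<forall>\<eta>\<in>Omega \<phi>. ball \<eta> r \<subseteq> Q"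
     "\<forall>\<eta>\<in>Omega \<phi>. \<forall>\<eta>'\<in>Omega \<phi>. \<eta> \<noteq> \<eta>' \<longrightarrow> ball \<eta> r \<inter> ball \<eta>' r = {}"
    by (elim exE conjE) (rule that)
  from bchoice[OF r(2)] obtain D where D: "\<forall>\<eta>\<in>Omega \<phi>. G \<eta> r (D \<eta>)" ..
  define K where "K = Q - (\<Union>\<eta>\<in>Omega \<phi>. ball \<eta> r)"
  have K: "compact K"
    unfolding K_def by (intro compact_diff Q open_UN) auto
  obtain \<rho> where \<rho>: "0 < \<rho>" "\<rho> < 1" "\<And>\<xi>. \<xi> \<in> K \<Longrightarrow> norm (fourier \<phi> \<xi>) \<le> \<rho>"
  proof (cases "K = {}")
    case True
    then show ?thesis using that[of "1/2"] by auto
  next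
    case False
    have "continuous_on K (\<lambda>\<xi>. norm (fourier \<phi> \<xi>))"
      by (intro continuous_intros continuous_on_subset[OF continuous_fourier[OF \<phi>]]) simp
    then obtain \<xi>0 where \<xi>0: "\<xi>0 \<in> K" "\<And>\<xi>. \<xi> \<in> K \<Longrightarrow> norm (fourier \<phi> \<xi>) \<le> norm (fourier \<phi> \<xi>0)"
      using continuous_attains_sup[OF K False] by blast
    have "\<xi>0 \<notin> Omega \<phi>" using \<xi>0(1) r(1) by (auto simp: K_def)
    then have "norm (fourier \<phi> \<xi>0) < 1"
      using a(2)[of \<xi>0] le_1[of \<xi>0] \<xi>0(1) by (auto simp: K_def Q_def order_le_less)
    then show ?thesis
      using \<xi>0(2) by (intro that[of "max (1/2) (norm (fourier \<phi> \<xi>0))"]) (auto simp: le_max_iff_disj)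
  qed
  have iQ: "integrable lborel (\<lambda>\<xi>. indicator Q \<xi> *\<^sub>R F n x \<xi>)" for n x
    unfolding F_def
    by (intro borel_integrable_compact Q continuous_intros continuous_on_subset[OF continuous_fourier[OF \<phi>]]) auto
  have iS: "integrable lborel (\<lambda>\<xi>. indicator S \<xi> *\<^sub>R F n x \<xi>)" if "S \<in> sets borel" "S \<subseteq> Q" for S n x
  proof -
    have "integrable lborel (\<lambda>\<xi>. indicator S \<xi> *\<^sub>R (indicator Q \<xi> *\<^sub>R F n x \<xi>))"
      using that(1) by (intro integrable_mult_indicator iQ) simp
    moreover have "(\<lambda>\<xi>. indicator S \<xi> *\<^sub>R (indicator Q \<xi> *\<^sub>R F n x \<xi>)) = (\<lambda>\<xi>. indicator S \<xi> *\<^sub>R F n x \<xi>)"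
      using that(2) by (auto simp: indicator_def fun_eq_iff)
    ultimately show ?thesis by (simp only:)
  qed
  have ind: "(indicator Q \<xi> :: real) = (\<Sum>\<eta>\<in>Omega \<phi>. indicator (ball \<eta> r) \<xi>) + indicator K \<xi>" for \<xi>
  proof -
    have "disjoint_family_on (\<lambda>\<eta>. ball \<eta> r) (Omega \<phi>)"
      using r(4) by (simp add: disjoint_family_on_def)
    then have "(\<Sum>\<eta>\<in>Omega \<phi>. indicator (ball \<eta> r) \<xi> :: real) = indicator (\<Union>\<eta>\<in>Omega \<phi>. ball \<eta> r) \<xi>"
      by (rule indicator_UN_disjoint[OF fin, symmetric])
    moreover have "indicator Q \<xi> = (indicator B \<xi> + indicator (Q - B) \<xi> :: real)" if "B \<subseteq> Q" for B
      using that by (auto simp: indicator_def)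
    from this[of "\<Union>\<eta>\<in>Omega \<phi>. ball \<eta> r"]
    have "indicator Q \<xi> = (indicator (\<Union>\<eta>\<in>Omega \<phi>. ball \<eta> r) \<xi> + indicator K \<xi> :: real)"
      unfolding K_def using r(3) by blast
    ultimately show ?thesis by (simp only:)
  qed
  show ?thesis
  proof (rule that[OF \<rho>(1,2)])
    show "(\<lambda>n. real n powr hom_order (hom_poly \<phi> \<eta>) * D \<eta> n) \<longlonglongrightarrow> 0" if "\<eta> \<in> Omega \<phi>" for \<eta>
      using bspec[OF D that] by (simp only: G_def)
    fix n :: nat and x :: "int^'d" assume n: "n > 0"
    let ?J = "\<lambda>S. LINT \<xi>|lborel. indicator S \<xi> *\<^sub>R F n x \<xi>"
    have "(2 * complex_of_real pi) ^ CARD('d) * conv_power \<phi> n x = ?J Q"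
      unfolding Q_def F_def by (rule conv_power_eq_integral[OF \<phi> n])
    also have "\<dots> = (LINT \<xi>|lborel. (\<Sum>\<eta>\<in>Omega \<phi>. indicator (ball \<eta> r) \<xi> *\<^sub>R F n x \<xi>) + indicator K \<xi> *\<^sub>R F n x \<xi>)"
      by (simp only: ind scaleR_add_left scaleR_sum_left)
    also have "\<dots> = (LINT \<xi>|lborel. (\<Sum>\<eta>\<in>Omega \<phi>. indicator (ball \<eta> r) \<xi> *\<^sub>R F n x \<xi>)) + ?J K"
      using r(3) compact_imp_closed[OF K]
      by (intro Bochner_Integration.integral_add Bochner_Integration.integrable_sum iS) (auto simp: K_def)
    also have "(LINT \<xi>|lborel. (\<Sum>\<eta>\<in>Omega \<phi>. indicator (ball \<eta> r) \<xi> *\<^sub>R F n x \<xi>)) = (\<Sum>\<eta>\<in>Omega \<phi>. ?J (ball \<eta> r))"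
      using r(3) by (intro Bochner_Integration.integral_sum iS) auto
    finally have eq: "(2 * complex_of_real pi) ^ CARD('d) * conv_power \<phi> n x - (\<Sum>\<eta>\<in>Omega \<phi>. T \<eta> n x)
        = (\<Sum>\<eta>\<in>Omega \<phi>. ?J (ball \<eta> r) - T \<eta> n x) + ?J K"
      by (simp add: sum_subtractf)
    have 1: "norm (\<Sum>\<eta>\<in>Omega \<phi>. ?J (ball \<eta> r) - T \<eta> n x) \<le> (\<Sum>\<eta>\<in>Omega \<phi>. D \<eta> n)"
      using D n unfolding G_def by (intro sum_norm_le) blast
    have 2: "norm (?J K) \<le> (LINT \<xi>|lborel. indicator K \<xi> *\<^sub>R \<rho> ^ n)"
    proof (rule Bochner_Integration.integral_norm_bound_integral)
      show "integrable lborel (\<lambda>\<xi>. indicator K \<xi> *\<^sub>R F n x \<xi>)"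
        using compact_imp_closed[OF K] by (intro iS) (auto simp: K_def)
      show "integrable lborel (\<lambda>\<xi>. indicator K \<xi> *\<^sub>R \<rho> ^ n)"
        by (intro borel_integrable_compact K continuous_intros)
      show "norm (indicator K \<xi> *\<^sub>R F n x \<xi>) \<le> indicator K \<xi> *\<^sub>R \<rho> ^ n" for \<xi>
        using \<rho>(3)[of \<xi>] by (auto simp: F_def indicator_def norm_mult norm_power intro!: power_mono)
    qed
    have 3: "(LINT \<xi>|lborel. indicator K \<xi> *\<^sub>R \<rho> ^ n) = measure lborel K * \<rho> ^ n"
      using compact_imp_closed[OF K] by simp
    show "norm ((2 * complex_of_real pi) ^ CARD('d) * conv_power \<phi> n x
        - (\<Sum>\<eta>\<in>Omega \<phi>. exp (- \<i> * complex_of_real (real_vec x \<bullet> \<eta>)) * fourier \<phi> \<eta> ^ n *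
             ((2 * complex_of_real pi) ^ CARD('d) *
              heat_kernel (hom_poly \<phi> \<eta>) (real n) (real_vec x - real n *\<^sub>R drift \<phi> \<eta>))))
        \<le> (\<Sum>\<eta>\<in>Omega \<phi>. D \<eta> n) + measure lborel K * \<rho> ^ n"
      unfolding T_def[symmetric] eq using norm_triangle_le[OF add_mono[OF 1 2]] by (simp only: 3)
  qed
qed

section \<open>The local limit theorem\<close>

theorem theorem1p5:
  fixes \<phi> :: "int ^ 'd \<Rightarrow> complex"
    and A :: nat and \<xi> :: "nat \<Rightarrow> real ^ 'd"
  assumes "\<phi> \<in> Schwartz"
    and "(SUP \<eta>. norm (fourier \<phi> \<eta>)) = 1"
    and "\<forall>\<eta> \<in> Omega \<phi>. pos_hom_type \<phi> \<eta>"
    and "bij_betw \<xi> {1..A} {\<eta> \<in> Omega \<phi>. hom_order (hom_poly \<phi> \<eta>) = mu \<phi>}"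
  shows "\<forall>\<epsilon>>0. \<forall>\<^sub>F n in sequentially. \<forall>x :: int ^ 'd.
    norm (conv_power \<phi> n x -
          (\<Sum>q=1..A. exp (- \<i> * complex_of_real (real_vec x \<bullet> \<xi> q)) * fourier \<phi> (\<xi> q) ^ n *
             heat_kernel (hom_poly \<phi> (\<xi> q)) (real n) (real_vec x - real n *\<^sub>R drift \<phi> (\<xi> q))))
      \<le> \<epsilon> * real n powr (- mu \<phi>)"
proof -
  note type = assms(3)
  have \<phi>: "(\<lambda>x. norm (\<phi> x)) summable_on UNIV"
    by (rule Schwartz_abs_summable[OF assms(1)])
  have fin: "finite (Omega \<phi>)" by (rule finite_Omega[OF \<phi> type])
  have le_1: "norm (fourier \<phi> \<eta>) \<le> 1" for \<eta>
  proof -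
    have "bdd_above (range (\<lambda>\<eta>. norm (fourier \<phi> \<eta>)))"
      by (rule bdd_aboveI2[OF norm_fourier_le[OF \<phi>]])
    from cSUP_upper[OF UNIV_I this] show ?thesis by (simp only: assms(2))
  qed
  define c where "c = (2 * complex_of_real pi) ^ CARD('d)"
  have c: "norm c > 0" by (simp add: c_def)
  define order where "order \<eta> = hom_order (hom_poly \<phi> \<eta>)" for \<eta>
  define W where "W \<eta> n x = exp (- \<i> * complex_of_real (real_vec x \<bullet> \<eta>)) * fourier \<phi> \<eta> ^ n *
     heat_kernel (hom_poly \<phi> \<eta>) (real n) (real_vec x - real n *\<^sub>R drift \<phi> \<eta>)"
    for \<eta> :: "real^'d" and n :: nat and x :: "int^'d"
  define M where "M = {\<eta> \<in> Omega \<phi>. order \<eta> = mu \<phi>}"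
  \<comment> \<open>Finiteness of \<open>Omega \<phi>\<close> makes \<open>Min\<close> a genuine lower bound.\<close>
  have order_ge: "mu \<phi> \<le> order \<eta>" if "\<eta> \<in> Omega \<phi>" for \<eta>
    unfolding mu_def order_def using that fin by (intro Min_le) auto
  obtain D \<rho> V where \<rho>: "0 < \<rho>" "\<rho> < (1::real)"
    and D: "\<And>\<eta>. \<eta> \<in> Omega \<phi> \<Longrightarrow> (\<lambda>n. real n powr order \<eta> * D \<eta> n) \<longlonglongrightarrow> 0"
    and main: "\<And>n x. n > 0 \<Longrightarrow> norm (c * conv_power \<phi> n x - (\<Sum>\<eta>\<in>Omega \<phi>. c * W \<eta> n x))
        \<le> (\<Sum>\<eta>\<in>Omega \<phi>. D \<eta> n) + V * \<rho> ^ n"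
  proof (rule conv_power_local_decomposition[OF \<phi> le_1 type, folded c_def order_def])
    fix D \<rho> V
    assume \<rho>: "0 < \<rho>" "\<rho> < (1::real)"
      and D: "\<And>\<eta>. \<eta> \<in> Omega \<phi> \<Longrightarrow> (\<lambda>n. real n powr order \<eta> * D \<eta> n) \<longlonglongrightarrow> 0"
      and main: "\<And>n x. n > 0 \<Longrightarrow> norm (c * conv_power \<phi> n x
        - (\<Sum>\<eta>\<in>Omega \<phi>. exp (- \<i> * complex_of_real (real_vec x \<bullet> \<eta>)) * fourier \<phi> \<eta> ^ n *
             (c * heat_kernel (hom_poly \<phi> \<eta>) (real n) (real_vec x - real n *\<^sub>R drift \<phi> \<eta>))))
        \<le> (\<Sum>\<eta>\<in>Omega \<phi>. D \<eta> n) + V * \<rho> ^ n"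
    show thesis
      by (rule that[OF \<rho> D]) (use main in \<open>simp_all only: W_def mult.left_commute[of c]\<close>)
  qed
  obtain C where C: "\<And>\<eta> n x. \<eta> \<in> Omega \<phi> \<Longrightarrow> n > 0 \<Longrightarrow>
      norm (c * heat_kernel (hom_poly \<phi> \<eta>) n x) \<le> C \<eta> * n powr (- order \<eta>)"
    using bchoice[of "Omega \<phi>" "\<lambda>\<eta> C. \<forall>n>0. \<forall>x. norm (c * heat_kernel (hom_poly \<phi> \<eta>) n x) \<le> C * n powr (- order \<eta>)"]
      heat_kernel_hom_poly_bound type unfolding c_def order_def by blast
  define Err where "Err n = (\<Sum>\<eta>\<in>Omega \<phi>. D \<eta> n) + V * \<rho> ^ n + (\<Sum>\<eta>\<in>Omega \<phi> - M. C \<eta> * real n powr (- order \<eta>))"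
    for n :: nat
  have bound: "norm (c * (conv_power \<phi> n x - (\<Sum>\<eta>\<in>M. W \<eta> n x))) \<le> Err n" if n: "n > 0" for n x
  proof -
    have "(\<Sum>\<eta>\<in>Omega \<phi>. c * W \<eta> n x) = (\<Sum>\<eta>\<in>Omega \<phi> - M. c * W \<eta> n x) + (\<Sum>\<eta>\<in>M. c * W \<eta> n x)"
      using fin by (intro sum.subset_diff) (auto simp: M_def)
    then have "c * (conv_power \<phi> n x - (\<Sum>\<eta>\<in>M. W \<eta> n x))
       = (c * conv_power \<phi> n x - (\<Sum>\<eta>\<in>Omega \<phi>. c * W \<eta> n x)) + (\<Sum>\<eta>\<in>Omega \<phi> - M. c * W \<eta> n x)"
      by (simp add: right_diff_distrib sum_distrib_left)
    moreover have "norm (\<Sum>\<eta>\<in>Omega \<phi> - M. c * W \<eta> n x) \<le> (\<Sum>\<eta>\<in>Omega \<phi> - M. C \<eta> * real n powr (- order \<eta>))"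
    proof (rule sum_norm_le)
      fix \<eta> assume \<eta>: "\<eta> \<in> Omega \<phi> - M"
      then have "norm (fourier \<phi> \<eta>) = 1" by (simp add: Omega_def)
      then have "norm (c * W \<eta> n x) = norm (c * heat_kernel (hom_poly \<phi> \<eta>) (real n) (real_vec x - real n *\<^sub>R drift \<phi> \<eta>))"
        by (simp add: W_def norm_mult norm_power)
      also have "\<dots> \<le> C \<eta> * real n powr (- order \<eta>)"
        using \<eta> n by (intro C) auto
      finally show "norm (c * W \<eta> n x) \<le> C \<eta> * real n powr (- order \<eta>)" .
    qed
    ultimately show ?thesis
      unfolding Err_def using main[OF n, of x] by (simp only: norm_triangle_le add_mono)
  qed
  have "(\<lambda>n. (\<Sum>\<eta>\<in>Omega \<phi>. real n powr mu \<phi> * D \<eta> n) + V * (real n powr mu \<phi> * \<rho> ^ n)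
      + (\<Sum>\<eta>\<in>Omega \<phi> - M. C \<eta> * (real n powr mu \<phi> * real n powr (- order \<eta>))))
     \<longlonglongrightarrow> (\<Sum>\<eta>\<in>Omega \<phi>. 0) + V * 0 + (\<Sum>\<eta>\<in>Omega \<phi> - M. C \<eta> * 0)"
  \<comment> \<open>The three parts are the local errors, the region of exponential decay, and the heat kernels of
      order strictly above \<open>mu \<phi>\<close>.\<close>
  proof (intro tendsto_add tendsto_sum tendsto_mult tendsto_const)
    show "(\<lambda>n. real n powr mu \<phi> * \<rho> ^ n) \<longlonglongrightarrow> 0"
      by (rule powr_mult_power_tendsto_0[OF \<rho>])
  next
    fix \<eta> assume \<eta>: "\<eta> \<in> Omega \<phi>"
    show "(\<lambda>n. real n powr mu \<phi> * D \<eta> n) \<longlonglongrightarrow> 0"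
    proof (rule Lim_null_comparison)
      show "\<forall>\<^sub>F n in sequentially. norm (real n powr mu \<phi> * D \<eta> n) \<le> \<bar>real n powr order \<eta> * D \<eta> n\<bar>"
        using eventually_ge_at_top[of 1]
      proof eventually_elim
        case (elim n)
        have "real n powr mu \<phi> \<le> real n powr order \<eta>"
          using elim order_ge[OF \<eta>] by (intro powr_mono) auto
        then show ?case by (simp add: abs_mult mult_right_mono)
      qed
      show "(\<lambda>n. \<bar>real n powr order \<eta> * D \<eta> n\<bar>) \<longlonglongrightarrow> 0"
        by (rule tendsto_rabs_zero[OF D[OF \<eta>]])
    qed
  next
    fix \<eta> assume \<eta>: "\<eta> \<in> Omega \<phi> - M"
    then have "mu \<phi> - order \<eta> < 0"
      using order_ge[of \<eta>] by (auto simp: M_def)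
    then have "(\<lambda>n. real n powr (mu \<phi> - order \<eta>)) \<longlonglongrightarrow> 0"
      using filterlim_real_sequentially by (rule tendsto_neg_powr)
    then show "(\<lambda>n. real n powr mu \<phi> * real n powr (- order \<eta>)) \<longlonglongrightarrow> 0"
      by (simp add: powr_add[symmetric])
  qed
  then have lim: "(\<lambda>n. real n powr mu \<phi> * Err n) \<longlonglongrightarrow> 0"
    by (simp add: Err_def distrib_left sum_distrib_left mult_ac)
  have reindex: "(\<Sum>q=1..A. W (\<xi> q) n x) = (\<Sum>\<eta>\<in>M. W \<eta> n x)" for n x
    unfolding M_def order_def by (rule sum.reindex_bij_betw[OF assms(4)])
  show ?thesis
  proof (intro allI impI)
    fix \<epsilon> :: real assume "\<epsilon> > 0"
    then have "norm c * \<epsilon> > 0" using c by simp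
    from order_tendstoD(2)[OF lim this] eventually_gt_at_top[of 0]
    show "\<forall>\<^sub>F n in sequentially. \<forall>x :: int ^ 'd.
      norm (conv_power \<phi> n x -
            (\<Sum>q=1..A. exp (- \<i> * complex_of_real (real_vec x \<bullet> \<xi> q)) * fourier \<phi> (\<xi> q) ^ n *
               heat_kernel (hom_poly \<phi> (\<xi> q)) (real n) (real_vec x - real n *\<^sub>R drift \<phi> (\<xi> q))))
        \<le> \<epsilon> * real n powr (- mu \<phi>)"
    proof eventually_elim
      case (elim n)
      show ?case
      proof
        fix x :: "int^'d"
        let ?d = "conv_power \<phi> n x - (\<Sum>q=1..A. W (\<xi> q) n x)"
        have "real n powr mu \<phi> * (norm c * norm ?d) \<le> real n powr mu \<phi> * Err n"
          unfolding reindex norm_mult[symmetric] by (intro mult_left_mono bound elim(2)) simp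
        also have "\<dots> < norm c * \<epsilon>" by (rule elim(1))
        finally have "norm c * (real n powr mu \<phi> * norm ?d) < norm c * \<epsilon>" by (simp add: mult_ac)
        then have "real n powr mu \<phi> * norm ?d \<le> \<epsilon>" using c by simp
        then have "norm ?d \<le> \<epsilon> * real n powr (- mu \<phi>)"
          using elim(2) by (simp add: powr_minus field_simps)
        then show "norm (conv_power \<phi> n x -
            (\<Sum>q=1..A. exp (- \<i> * complex_of_real (real_vec x \<bullet> \<xi> q)) * fourier \<phi> (\<xi> q) ^ n *
               heat_kernel (hom_poly \<phi> (\<xi> q)) (real n) (real_vec x - real n *\<^sub>R drift \<phi> (\<xi> q))))
          \<le> \<epsilon> * real n powr (- mu \<phi>)" by (simp only: W_def)
      qed
    qed
  qed
qed

end
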